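(* If $n\geq 9$, then $R(S_n[5],W_8)=2n-1$.
   Context: All graphs are finite and simple. For graphs $G,H$, $R(G,H)$ is the smallest $N$ such that every graph $F$ of order $N$ either contains $G$ as a subgraph or has complement $\overline{F}$ containing $H$. $W_8$ is the wheel of order 9 (a hub joined to every vertex of a cycle $C_8$). $S_k$ is the star of order $k$. $S_n[5]$ is the tree of order $n$ obtained by adding an edge joining the center of $S_{n-5}$ to a degree-one vertex of $S_5$. *)

theory Defs
  imports Main "HOL-Library.Ramsey"
begin

record 'a sgraph =
  verts :: "'a set"
  edges :: "'a set set"

definition simple_graph :: "'a sgraph \<Rightarrow> bool" where
  "simple_graph G \<longleftrightarrow> finite (verts G) \<and> edges G \<subseteq> nsets (verts G) 2"

definition complement :: "'a sgraph \<Rightarrow> 'a sgraph" where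
  "complement G = \<lparr>verts = verts G, edges = nsets (verts G) 2 - edges G\<rparr>"

text \<open>A (not necessarily induced) copy of \<open>G\<close> in \<open>F\<close>.\<close>

definition contains_subgraph :: "'a sgraph \<Rightarrow> 'b sgraph \<Rightarrow> bool" where
  "contains_subgraph F G \<longleftrightarrow>
     (\<exists>f. inj_on f (verts G) \<and> f ` verts G \<subseteq> verts F \<and> (\<forall>e\<in>edges G. f ` e \<in> edges F))"

text \<open>Host graphs are taken on vertices of type \<^typ>\<open>nat\<close>; this covers all finite graphs up to
  isomorphism, see \<open>ramsey_arrow_any_type\<close> below.\<close>

definition ramsey_arrow :: "nat \<Rightarrow> 'a sgraph \<Rightarrow> 'b sgraph \<Rightarrow> bool" where
  "ramsey_arrow N G H \<longleftrightarrow>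
     (\<forall>F :: nat sgraph. simple_graph F \<and> card (verts F) = N \<longrightarrow>
        contains_subgraph F G \<or> contains_subgraph (complement F) H)"

definition ramsey_number :: "'a sgraph \<Rightarrow> 'b sgraph \<Rightarrow> nat" where
  "ramsey_number G H = (LEAST N. ramsey_arrow N G H)"

text \<open>The wheel with rim the cycle \<open>0, \<dots>, m - 1\<close> and hub \<open>m\<close>; its order is \<open>m + 1\<close>.
  Intended for \<open>m \<ge> 3\<close>.\<close>

definition wheel :: "nat \<Rightarrow> nat sgraph" where
  "wheel m = \<lparr>verts = {..m},
              edges = {{i, Suc i mod m} | i. i < m} \<union> {{m, i} | i. i < m}\<rparr>"

definition star :: "'a \<Rightarrow> 'a set \<Rightarrow> 'a sgraph" where
  "star c L = \<lparr>verts = insert c L, edges = {{c, x} | x. x \<in> L}\<rparr>"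

text \<open>\<open>S\<^sub>n[m]\<close>: the stars of order \<open>n - m\<close> and \<open>m\<close>, with centers \<open>0\<close> and \<open>n - m\<close>, on disjoint
  vertex sets, and an edge from the first center to the leaf \<open>n - m + 1\<close> of the second star.
  Intended for \<open>m \<ge> 2\<close> and \<open>n > m\<close>.\<close>

definition star_tree :: "nat \<Rightarrow> nat \<Rightarrow> nat sgraph" where
  "star_tree n m =
     (let A = star 0 {1..<n - m};
          B = star (n - m) {n - m + 1..<n}
      in \<lparr>verts = verts A \<union> verts B,
          edges = edges A \<union> edges B \<union> {{0, n - m + 1}}\<rparr>)"

lemma simple_graph_wheel: "m \<ge> 3 \<Longrightarrow> simple_graph (wheel m)"
proof -
  assume m: "m \<ge> 3"
  have "{i, Suc i mod m} \<in> nsets {..m} 2" if "i < m" for i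
  proof -
    have "Suc i mod m \<noteq> i"
      using that m by (cases "Suc i = m") auto
    moreover have "Suc i mod m < m"
      using m by simp
    ultimately show ?thesis
      using that by (auto simp: nsets_def card_2_iff)
  qed
  then show ?thesis
    by (fastforce simp: simple_graph_def wheel_def nsets_def card_2_iff)
qed

lemma simple_graph_star_tree:
  assumes "2 \<le> m" "m < n"
  shows "simple_graph (star_tree n m)" "card (verts (star_tree n m)) = n"
proof -
  have v: "verts (star_tree n m) = {..<n}"
    using assms by (auto simp: star_tree_def star_def)
  then show "card (verts (star_tree n m)) = n"
    by simp
  show "simple_graph (star_tree n m)"
    unfolding simple_graph_def v
    using assms by (auto simp: star_tree_def star_def nsets_def card_insert_if)
qed

lemma contains_subgraph_map:
  assumes "contains_subgraph K' A"
    and h: "inj_on h (verts K')" "h ` verts K' \<subseteq> verts K"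
    and E: "\<And>e. e \<in> edges K' \<Longrightarrow> h ` e \<in> edges K"
  shows "contains_subgraph K A"
proof -
  obtain f where f: "inj_on f (verts A)" "f ` verts A \<subseteq> verts K'" "\<forall>e\<in>edges A. f ` e \<in> edges K'"
    using assms by (auto simp: contains_subgraph_def)
  have "inj_on (h \<circ> f) (verts A)"
    using f h by (meson comp_inj_on inj_on_subset)
  moreover have "(h \<circ> f) ` verts A \<subseteq> verts K"
    using f h by fastforce
  moreover have "\<forall>e\<in>edges A. (h \<circ> f) ` e \<in> edges K"
    using f E by (metis image_comp)
  ultimately show ?thesis
    unfolding contains_subgraph_def by blast
qed

lemma ramsey_arrow_any_type:
  fixes F :: "'c sgraph"
  assumes arrow: "ramsey_arrow N G H"
    and F: "simple_graph F" "card (verts F) = N"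
  shows "contains_subgraph F G \<or> contains_subgraph (complement F) H"
proof -
  have fin: "finite (verts F)" and EF: "edges F \<subseteq> nsets (verts F) 2"
    using F by (auto simp: simple_graph_def)
  obtain g :: "'c \<Rightarrow> nat" where g: "inj_on g (verts F)"
    using finite_imp_inj_to_nat_seg[OF fin] by auto
  define h where "h = inv_into (verts F) g"
  have hg: "h ` g ` e = e" if "e \<subseteq> verts F" for e
    using that g unfolding h_def by (simp add: inv_into_image_cancel)
  have injh: "inj_on h (g ` verts F)"
    unfolding h_def by (rule inj_on_inv_into) simp
  have gE: "g ` e \<in> nsets (g ` verts F) 2" if "e \<in> nsets (verts F) 2" for e
  proof -
    have e: "e \<subseteq> verts F" "finite e" "card e = 2"
      using that by (simp_all add: nsets_def)
    then show ?thesis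
      using card_image[OF inj_on_subset[OF g e(1)]] image_mono[OF e(1), of g] by (simp add: nsets_def)
  qed
  have hE: "h ` e \<in> nsets (verts F) 2 \<and> g ` h ` e = e" if "e \<in> nsets (g ` verts F) 2" for e
  proof -
    have e: "e \<subseteq> g ` verts F" "card e = 2"
      using that by (simp_all add: nsets_def)
    from e(1) obtain d where d: "d \<subseteq> verts F" "e = g ` d"
      unfolding subset_image_iff by blast
    have "card d = 2"
      using e(2) card_image[OF inj_on_subset[OF g d(1)]] d(2) by simp
    moreover have "h ` e = d"
      using hg[OF d(1)] d(2) by simp
    ultimately show ?thesis
      using d finite_subset[OF d(1) fin] by (simp add: nsets_def)
  qed
  define F' where "F' = \<lparr>verts = g ` verts F, edges = (`) g ` edges F\<rparr>"
  have "(`) g ` edges F \<subseteq> nsets (g ` verts F) 2"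
    using gE EF by blast
  then have "simple_graph F'"
    using fin by (simp add: F'_def simple_graph_def)
  moreover have "card (verts F') = N"
    using F(2) card_image[OF g] by (simp add: F'_def)
  ultimately have *: "contains_subgraph F' G \<or> contains_subgraph (complement F') H"
    using arrow unfolding ramsey_arrow_def by blast
  have 1: "h ` e \<in> edges F" if "e \<in> edges F'" for e
  proof -
    obtain d where "d \<in> edges F" "e = g ` d"
      using \<open>e \<in> edges F'\<close> by (auto simp: F'_def)
    moreover have "d \<subseteq> verts F"
      using EF \<open>d \<in> edges F\<close> by (auto simp: nsets_def)
    ultimately show ?thesis
      using hg by simp
  qed
  have 2: "h ` e \<in> edges (complement F)" if "e \<in> edges (complement F')" for e
  proof -
    have e: "e \<in> nsets (g ` verts F) 2" "e \<notin> (`) g ` edges F"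
      using that by (simp_all add: complement_def F'_def)
    have "h ` e \<notin> edges F"
      using hE[OF e(1)] e(2) imageI[of "h ` e" "edges F" "(`) g"] by argo
    then show ?thesis
      using hE[OF e(1)] by (simp add: complement_def)
  qed
  have vs: "verts F' = g ` verts F" "verts (complement F') = g ` verts F"
    "verts (complement F) = verts F"
    by (auto simp: F'_def complement_def)
  from * show ?thesis
  proof
    assume "contains_subgraph F' G"
    then have "contains_subgraph F G"
      by (rule contains_subgraph_map[where h = h]) (simp_all add: vs injh hg 1)
    then show ?thesis ..
  next
    assume "contains_subgraph (complement F') H"
    then have "contains_subgraph (complement F) H"
      by (rule contains_subgraph_map[where h = h]) (simp_all add: vs injh hg 2)
    then show ?thesis ..
  qed
qed

end

theory Submission
  imports Defs
begin

text \<open>Lower bound: two disjoint cliques on at most \<open>n - 1\<close> vertices each. Upper bound: let \<open>F\<close> on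
  \<open>2n - 1\<close> vertices be a counterexample, with complement \<open>H\<close>. If all degrees of \<open>F\<close> are at most
  \<open>n - 6\<close>, consider the \<open>H\<close>-neighborhood \<open>B\<close> of a vertex \<open>x\<close>. A vertex of \<open>B\<close> with few \<open>F\<close>-neighbors
  outside \<open>B\<close> has at most three \<open>H\<close>-neighbors in \<open>B\<close> of the same kind, while any three of the remaining
  vertices of \<open>B\<close> have \<open>H\<close>-degree sum at least \<open>|B| + 16\<close> in \<open>B\<close>, so two of them have six common
  neighbors; by \<open>R(C\<^sub>4, K\<^sub>3) \<le> 7\<close> there are at most six of them, which then yields a \<open>K\<^sub>4\<^sub>,\<^sub>4\<close> in \<open>B\<close>.
  If instead some \<open>v\<close> has degree at least \<open>n - 5\<close>, the absence of \<open>S\<^sub>n[5]\<close> restricts the edges between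
  its neighborhood and the rest so much that either a rim \<open>C\<^sub>8\<close> is found by the theorems of Dirac and
  Jackson, or \<open>H\<close> is nearly complete bipartite; then \<open>n\<close> vertices on one side have \<open>H\<close>-degree at most
  three on that side and span an \<open>S\<^sub>n[5]\<close>.\<close>

subsection \<open>Cycles of length eight\<close>

text \<open>Repeating the head turns the closing edge into an ordinary consecutive pair, so that
  Dirac's argument can treat all edges of the cycle alike.\<close>

definition has_C8 :: "('a \<Rightarrow> 'a \<Rightarrow> bool) \<Rightarrow> 'a set \<Rightarrow> bool" where
  "has_C8 R S \<longleftrightarrow>
     (\<exists>xs. length xs = 8 \<and> distinct xs \<and> set xs \<subseteq> S \<and> successively R (xs @ [hd xs]))"

lemma has_C8_mono: "has_C8 R S \<Longrightarrow> S \<subseteq> T \<Longrightarrow> has_C8 R T"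
  unfolding has_C8_def by blast

section \<open>Eight-cycles with four given vertices in alternate positions\<close>

lemma ex_notin_if_card_less:
  assumes "card F < card X" "finite F"
  shows "\<exists>x\<in>X. x \<notin> F"
  using assms by (metis card_mono leD subsetI)

text \<open>Greedy choice: each set has more elements than have been picked before it.\<close>

lemma distinct_representatives4:
  assumes "1 \<le> card A" "2 \<le> card B" "3 \<le> card C" "4 \<le> card D"
  shows "\<exists>a\<in>A. \<exists>b\<in>B. \<exists>c\<in>C. \<exists>d\<in>D. distinct [a, b, c, d]"
proof -
  obtain a where a: "a \<in> A"
    using assms(1) ex_notin_if_card_less[of "{}" A] by auto
  obtain b where b: "b \<in> B" "b \<notin> {a}"
    using assms(2) ex_notin_if_card_less[of "{a}" B] by auto
  obtain c where c: "c \<in> C" "c \<notin> {a, b}"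
    using assms(3) b ex_notin_if_card_less[of "{a, b}" C] by auto
  obtain d where d: "d \<in> D" "d \<notin> {a, b, c}"
    using assms(4) b c ex_notin_if_card_less[of "{a, b, c}" D] by auto
  show ?thesis
    using a b c d by (intro bexI[of _ a] bexI[of _ b] bexI[of _ c] bexI[of _ d]) auto
qed

lemma has_C8I:
  assumes "symp R" "distinct [a, b, c, d]" "{a, b, c, d} \<inter> Y = {}"
    and "distinct [p, q, r, s]" "{p, q, r, s} \<subseteq> Y"
    and "R a p" "R b p" "R b q" "R c q" "R c r" "R d r" "R d s" "R a s"
  shows "has_C8 R ({a, b, c, d} \<union> Y)"
  unfolding has_C8_def
  using assms by (intro exI[of _ "[a, p, b, q, c, r, d, s]"]) (auto dest: sympD)

text \<open>Each gap of the cyclic order \<open>a, b, c, d\<close> needs its own connector from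
  \<open>Y\<close>. Filled in this order, the k-th gap has at least k candidates.\<close>

lemma has_C8_greedy:
  fixes R :: "'a \<Rightarrow> 'a \<Rightarrow> bool" and Y :: "'a set"
  defines "C \<equiv> \<lambda>a b. {y\<in>Y. R a y \<and> R b y}"
  assumes "symp R" "distinct [a, b, c, d]" "{a, b, c, d} \<inter> Y = {}"
    and "1 \<le> card (C a b)" "2 \<le> card (C b c)" "3 \<le> card (C c d)" "4 \<le> card (C d a)"
  shows "has_C8 R ({a, b, c, d} \<union> Y)"
proof -
  obtain p q r s where "p \<in> C a b" "q \<in> C b c" "r \<in> C c d" "s \<in> C d a" "distinct [p, q, r, s]"
    using distinct_representatives4[OF assms(5-8)] by blast
  then show ?thesis
    using assms(2-4) by (intro has_C8I[where p = p and q = q and r = r and s = s]) (auto simp: C_def)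
qed

lemma card_4_obtain:
  assumes "card Z = 4" "a \<in> Z" "b \<in> Z" "a \<noteq> b"
  obtains c d where "Z = {a, b, c, d}" "distinct [a, b, c, d]"
proof -
  have "finite Z"
    using assms(1) card.infinite by force
  then have "card (Z - {a, b}) = 2"
    using assms by (simp add: card_Diff_subset)
  then obtain c d where cd: "Z - {a, b} = {c, d}" "c \<noteq> d"
    by (auto simp: card_2_iff)
  then have "Z = {a, b, c, d}" "distinct [a, b, c, d]"
    using assms(2-4) by auto
  then show ?thesis
    using that by blast
qed

lemma card_4_obtain3:
  assumes "card Z = 4" "a \<in> Z" "b \<in> Z" "c \<in> Z" "distinct [a, b, c]"
  obtains d where "Z = {a, b, c, d}" "distinct [a, b, c, d]"
proof -
  obtain d e where de: "Z = {a, b, d, e}" "distinct [a, b, d, e]"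
    using card_4_obtain[OF assms(1-3)] assms(5) by auto
  then have "c = d \<or> c = e"
    using assms(4,5) by auto
  then show ?thesis
    using that[of d] that[of e] de by auto
qed

text \<open>Jackson's theorem on long cycles in bipartite graphs, for a side of four vertices. If \<open>r y\<close> is
  the number of vertices of \<open>Z\<close> missing \<open>y\<close>, the cases are: some vertex of \<open>Z\<close> misses nothing; some
  \<open>y\<close> has \<open>r y = 2\<close>; every vertex of \<open>Z\<close> misses some \<open>y\<close> with \<open>r y = 1\<close>; some vertex misses only \<open>y\<close>
  with \<open>r y \<ge> 3\<close>.\<close>

lemma has_C8_bipartite:
  fixes R :: "'a \<Rightarrow> 'a \<Rightarrow> bool"
  assumes R: "symp R" and Y: "finite Y" and Z: "card Z = 4" "Z \<inter> Y = {}"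
    and miss: "\<And>z. z \<in> Z \<Longrightarrow> card {y\<in>Y. \<not> R z y} \<le> m"
    and m: "m + 4 \<le> card Y" "2 * m + 2 \<le> card Y"
  shows "has_C8 R (Z \<union> Y)"
proof -
  define M where "M = (\<lambda>z. {y\<in>Y. \<not> R z y})"
  define C where "C = (\<lambda>a b. {y\<in>Y. R a y \<and> R b y})"
  have fM: "finite (M z)" for z
    using Y by (simp add: M_def)
  have fC: "finite (C a b)" for a b
    using Y by (simp add: C_def)
  have C_comm: "C a b = C b a" for a b
    by (auto simp: C_def)
  have Mle: "card (M z) \<le> m" if "z \<in> Z" for z
    using miss[OF that] by (simp add: M_def)
  have cC: "card (C a b) + card (M a) + card (M b) = card Y + card (M a \<inter> M b)" for a b
  proof -
    have "C a b = Y - (M a \<union> M b)" "M a \<union> M b \<subseteq> Y"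
      by (auto simp: C_def M_def)
    then have "card (C a b) + card (M a \<union> M b) = card Y"
      using Y by (metis card_Diff_subset card_mono finite_subset le_add_diff_inverse2)
    then show ?thesis
      using card_Un_Int[OF fM fM, of a b] by simp
  qed
  \<comment> \<open>The bound \<open>2 * m + 2 \<le> card Y\<close> gives every pair two common
    neighbours, and each vertex missed by both adds one. The greedy cases below only have to raise
    two gaps with a common end to 3 and 4.\<close>
  have C2: "card (C a b) \<ge> 2 + card (M a \<inter> M b)" if "a \<in> Z" "b \<in> Z" for a b
    using cC[of a b] Mle[OF that(1)] Mle[OF that(2)] m by linarith
  have greedy: "has_C8 R (Z \<union> Y)"
    if "Z = {a, b, c, d}" "distinct [a, b, c, d]" "3 \<le> card (C c d)" "4 \<le> card (C d a)" for a b c d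
    using has_C8_greedy[of R a b c d Y] R Z(2) that C2[of a b] C2[of b c] by (simp add: C_def)
  have Z4: "finite Z" "\<exists>z\<in>Z. z \<noteq> a" for a
    using Z(1) card.infinite ex_notin_if_card_less[of "{a}" Z] by force+
  show ?thesis
  proof (cases "\<exists>z\<in>Z. M z = {}")
    case True
    then obtain d where d: "d \<in> Z" "M d = {}"
      by blast
    obtain a where "a \<in> Z" "a \<noteq> d"
      using Z4 by blast
    then obtain b c where bc: "Z = {d, a, b, c}" "distinct [d, a, b, c]"
      using card_4_obtain[OF Z(1) d(1)] by metis
    then have Zeq: "Z = {a, b, c, d}" "distinct [a, b, c, d]"
      by auto
    \<comment> \<open>As \<open>d\<close> misses nothing, only the misses of \<open>x\<close> count,
      and \<open>m + 4 \<le> card Y\<close> suffices.\<close>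
    have "card (C x d) \<ge> 4" if "x \<in> Z" for x
      using cC[of x d] Mle[OF that] m d by simp
    from this[of a] this[of c] have "card (C d a) \<ge> 4" "card (C c d) \<ge> 4"
      using Zeq(1) C_comm[of a d] by simp_all
    then show ?thesis
      using greedy[OF Zeq] by simp
  next
    case noempty: False
    show ?thesis
    proof (cases "\<exists>e\<in>Y. card {z\<in>Z. e \<in> M z} = 2")
      case True
      then obtain e a b where e: "e \<in> Y" "{z\<in>Z. e \<in> M z} = {a, b}" "a \<noteq> b"
        by (auto simp: card_2_iff)
      then have ab: "a \<in> Z" "b \<in> Z" "e \<in> M a" "e \<in> M b"
        by auto
      then obtain c d where Zeq: "Z = {a, b, c, d}" "distinct [a, b, c, d]"
        using card_4_obtain[OF Z(1)] e(3) by metis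
      \<comment> \<open>\<open>e\<close> fills the gap between \<open>c\<close> and
        \<open>d\<close>. It differs from the other three connectors, since each of those is
        adjacent to \<open>a\<close> or \<open>b\<close>.\<close>
      have "e \<notin> M c" "e \<notin> M d"
        using e(2) Zeq by auto
      then have ecd: "R c e" "R d e"
        using e(1) by (auto simp: M_def)
      have "card (M a \<inter> M b) \<ge> 1"
        using ab fM by (metis IntI One_nat_def Suc_leI card_gt_0_iff empty_iff finite_Int)
      then have "card (C a b) \<ge> 3" "card (C b c) \<ge> 2" "card (C d a) \<ge> 2"
        using C2[of a b] C2[of b c] C2[of d a] Zeq by auto
      then obtain q where q: "q \<in> C b c"
        using ex_notin_if_card_less[of "{}" "C b c"] by auto
      obtain t where t: "t \<in> C d a" "t \<noteq> q"
        using ex_notin_if_card_less[of "{q}" "C d a"] \<open>card (C d a) \<ge> 2\<close> by auto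
      obtain s where s: "s \<in> C a b" "s \<noteq> q" "s \<noteq> t"
        using ex_notin_if_card_less[of "{q, t}" "C a b"] \<open>card (C a b) \<ge> 3\<close> t(2) by auto
      have "has_C8 R ({a, b, c, d} \<union> Y)"
        by (rule has_C8I[where p = s and q = q and r = e and s = t])
          (use R Z(2) Zeq ecd e(1) ab q s t in \<open>auto simp: C_def M_def\<close>)
      then show ?thesis
        using Zeq by simp
    next
      case no2: False
      show ?thesis
      proof (cases "\<forall>z\<in>Z. \<exists>e\<in>M z. \<forall>z'\<in>Z. z' \<noteq> z \<longrightarrow> e \<notin> M z'")
        case True
        then obtain e where e: "\<And>z. z \<in> Z \<Longrightarrow> e z \<in> M z"
            "\<And>z z'. z \<in> Z \<Longrightarrow> z' \<in> Z \<Longrightarrow> z' \<noteq> z \<Longrightarrow> e z \<notin> M z'"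
          by metis
        obtain a where "a \<in> Z"
          using Z4 by blast
        moreover obtain b where "b \<in> Z" "b \<noteq> a"
          using Z4 by blast
        ultimately obtain c d where Zeq: "Z = {a, b, c, d}" "distinct [a, b, c, d]"
          using card_4_obtain[OF Z(1)] by metis
        have Re: "R z' (e z)" if "z \<in> Z" "z' \<in> Z" "z' \<noteq> z" for z z'
          using e(1)[OF that(1)] e(2)[OF that] by (simp add: M_def)
        have eY: "e z \<in> Y" if "z \<in> Z" for z
          using e(1)[OF that] by (simp add: M_def)
        have inj: "e z = e z' \<longleftrightarrow> z = z'" if "z \<in> Z" "z' \<in> Z" for z z'
          using e(1)[OF that(2)] e(2)[OF that] by metis
        have in_Z: "a \<in> Z" "b \<in> Z" "c \<in> Z" "d \<in> Z"
          using Zeq by auto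
        \<comment> \<open>The gaps \<open>ab\<close>, \<open>bc\<close>, \<open>cd\<close>,
          \<open>da\<close> receive the private missed vertices of \<open>c\<close>,
          \<open>d\<close>, \<open>a\<close>, \<open>b\<close>; none of them is missed by an end of
          its gap.\<close>
        have "distinct [e c, e d, e a, e b]"
          using Zeq(2) in_Z inj by auto
        moreover have "R a (e c)" "R b (e c)" "R b (e d)" "R c (e d)" "R c (e a)" "R d (e a)"
            "R d (e b)" "R a (e b)"
          using Zeq(2) in_Z Re by auto
        moreover have "{e c, e d, e a, e b} \<subseteq> Y"
          using in_Z eY by simp
        ultimately show ?thesis
          using has_C8I[of R a b c d Y "e c" "e d" "e a" "e b"] R Z(2) Zeq by argo
      next
        case False
        then obtain a where a: "a \<in> Z" "\<And>e. e \<in> M a \<Longrightarrow> \<exists>z\<in>Z. z \<noteq> a \<and> e \<in> M z"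
          by metis
        \<comment> \<open>No vertex of \<open>Y\<close> is missed exactly twice, so a second miss
          forces a third.\<close>
        have two: "\<exists>b c. b \<in> Z \<and> c \<in> Z \<and> distinct [a, b, c] \<and> e \<in> M b \<and> e \<in> M c" if e: "e \<in> M a" for e
        proof -
          obtain b where b: "b \<in> Z" "b \<noteq> a" "e \<in> M b"
            using a(2)[OF e] by blast
          have "e \<in> Y"
            using e by (simp add: M_def)
          then have "{z\<in>Z. e \<in> M z} \<noteq> {a, b}"
            using no2 b(2) by (metis card_2_iff)
          then obtain c where "c \<in> Z" "e \<in> M c" "c \<noteq> a" "c \<noteq> b"
            using a(1) b e by blast
          then show ?thesis
            using b by auto
        qed
        have pos: "card (M x \<inter> M y) \<ge> 1" if "e \<in> M x" "e \<in> M y" for e x y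
          using that fM by (metis IntI One_nat_def Suc_leI card_gt_0_iff empty_iff finite_Int)
        obtain e where e: "e \<in> M a"
          using noempty a(1) by blast
        show ?thesis
        proof (cases "M a = {e}")
          case True
          obtain b c where bc: "b \<in> Z" "c \<in> Z" "distinct [a, b, c]" "e \<in> M b" "e \<in> M c"
            using two[OF e] by blast
          obtain d where Zeq: "Z = {a, b, c, d}" "distinct [a, b, c, d]"
            using card_4_obtain3[OF Z(1) a(1) bc(1-3)] by metis
          \<comment> \<open>The only miss of \<open>a\<close> is shared with \<open>x\<close>, so
            the pair loses at most \<open>m\<close> vertices in total.\<close>
          have "card (C a x) \<ge> 4" if "x \<in> Z" "e \<in> M x" for x
            using cC[of a x] Mle[OF that(1)] m True pos[OF e that(2)] by simp
          then have "card (C a b) \<ge> 4" "card (C a c) \<ge> 4"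
            using bc by blast+
          then show ?thesis
            using greedy[of b d c a] Zeq C_comm[of c a] by (auto simp: insert_commute)
        next
          case False
          then obtain f where f: "f \<in> M a" "f \<noteq> e"
            using e by blast
          obtain b c where bc: "b \<in> Z" "c \<in> Z" "distinct [a, b, c]" "e \<in> M b" "e \<in> M c"
            using two[OF e] by blast
          obtain d where Zeq: "Z = {a, b, c, d}" "distinct [a, b, c, d]"
            using card_4_obtain3[OF Z(1) a(1) bc(1-3)] by metis
          \<comment> \<open>\<open>f\<close> is missed by two of \<open>b\<close>, \<open>c\<close>,
            \<open>d\<close>, hence by \<open>b\<close> or \<open>c\<close>. That vertex shares both
            \<open>e\<close> and \<open>f\<close> with \<open>a\<close>; the other one still shares
            \<open>e\<close>.\<close>
          have "f \<in> M b \<or> f \<in> M c"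
            using two[OF f(1)] Zeq by auto
          moreover have ge4: "card (C a x) \<ge> 4" if "x \<in> Z" "e \<in> M x" "f \<in> M x" for x
          proof -
            have "card {e, f} \<le> card (M a \<inter> M x)"
              using that e f fM by (intro card_mono) auto
            then show ?thesis
              using C2[OF a(1) that(1)] f(2) by simp
          qed
          moreover have "card (C a x) \<ge> 3" if "x \<in> Z" "e \<in> M x" for x
            using C2[OF a(1) that(1)] pos[OF e that(2)] by simp
          ultimately consider "card (C a b) \<ge> 4" "card (C a c) \<ge> 3" | "card (C a b) \<ge> 3" "card (C a c) \<ge> 4"
            using bc by blast
          then show ?thesis
          proof cases
            case 1
            then show ?thesis
              using greedy[of b d c a] Zeq C_comm[of c a] by (auto simp: insert_commute)
          next
            case 2
            then show ?thesis
              using greedy[of c d b a] Zeq C_comm[of b a] by (auto simp: insert_commute)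
          qed
        qed
      qed
    qed
  qed
qed

section \<open>Dirac's theorem by counting breaks\<close>

fun breaks :: "('a \<Rightarrow> 'a \<Rightarrow> bool) \<Rightarrow> 'a list \<Rightarrow> nat" where
  "breaks R (x # y # zs) = (if R x y then 0 else 1) + breaks R (y # zs)"
| "breaks R [] = 0"
| "breaks R [x] = 0"

lemma breaks_eq_0_iff: "breaks R xs = 0 \<longleftrightarrow> successively R xs"
  by (induction R xs rule: breaks.induct) auto

lemma breaks_append:
  assumes "xs \<noteq> []" "ys \<noteq> []"
  shows "breaks R (xs @ ys) = breaks R xs + (if R (last xs) (hd ys) then 0 else 1) + breaks R ys"
  using assms
proof (induction R xs rule: breaks.induct)
  case (3 R x)
  then show ?case
    by (cases ys) auto
qed auto

lemma breaks_rev: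
  assumes "symp R"
  shows "breaks R (rev xs) = breaks R xs"
proof (induction xs)
  case (Cons x xs)
  have "R x y \<longleftrightarrow> R y x" for y
    using assms by (auto dest: sympD)
  then show ?case
    using Cons breaks_append[of "rev xs" "[x]" R] breaks_append[of "[x]" xs R]
    by (cases "xs = []") (simp_all add: last_rev)
qed auto

lemma breaks_split:
  assumes "breaks R xs \<noteq> 0"
  shows "\<exists>ys zs. xs = ys @ zs \<and> ys \<noteq> [] \<and> zs \<noteq> [] \<and> \<not> R (last ys) (hd zs)"
  using assms
proof (induction R xs rule: breaks.induct)
  case (1 R x y zs)
  show ?case
  proof (cases "R x y")
    case True
    then obtain us vs where "y # zs = us @ vs" "us \<noteq> []" "vs \<noteq> []" "\<not> R (last us) (hd vs)"
      using 1 by auto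
    then show ?thesis
      by (intro exI[of _ "x # us"] exI[of _ vs]) auto
  next
    case False
    then show ?thesis
      by (intro exI[of _ "[x]"] exI[of _ "y # zs"]) auto
  qed
qed auto

definition cyclic_breaks :: "('a \<Rightarrow> 'a \<Rightarrow> bool) \<Rightarrow> 'a list \<Rightarrow> nat" where
  "cyclic_breaks R xs = breaks R (xs @ [hd xs])"

lemma cyclic_breaks_rotate:
  "cyclic_breaks R (xs @ ys) = cyclic_breaks R (ys @ xs)"
  by (cases "xs = [] \<or> ys = []") (auto simp: cyclic_breaks_def breaks_append)

text \<open>Dirac's theorem, by 2-opt exchanges: in a cyclic order with as few breaks as possible, a break can
  be removed by reversing a segment.\<close>

lemma dirac:
  assumes R: "symp R" and S: "finite S"
    and deg: "\<And>x. x \<in> S \<Longrightarrow> card S \<le> 2 * card {y\<in>S. y \<noteq> x \<and> R x y}"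
  shows "\<exists>xs. distinct xs \<and> set xs = S \<and> successively R (xs @ [hd xs])"
proof -
  let ?P = "\<lambda>xs. distinct xs \<and> set xs = S"
  obtain xs0 where "?P xs0"
    using finite_distinct_list[OF S] by blast
  then obtain xs where xs: "?P xs" and least: "\<And>ys. ?P ys \<Longrightarrow> cyclic_breaks R xs \<le> cyclic_breaks R ys"
    using ex_has_least_nat[of ?P xs0 "cyclic_breaks R"] by blast
  have "cyclic_breaks R xs = 0"
  proof (rule ccontr)
    assume ne0: "cyclic_breaks R xs \<noteq> 0"
    then have "breaks R (xs @ [hd xs]) \<noteq> 0"
      by (simp add: cyclic_breaks_def)
    then obtain us vs where uv: "xs @ [hd xs] = us @ vs" "us \<noteq> []" "vs \<noteq> []" "\<not> R (last us) (hd vs)"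
      using breaks_split by blast
    have "xs \<noteq> []"
      using ne0 by (auto simp: cyclic_breaks_def)
    \<comment> \<open>Rotation moves the break to the closing pair; if \<open>vs\<close> is a single
      element, the break is there already.\<close>
    obtain ys where ys: "?P ys" "cyclic_breaks R ys = cyclic_breaks R xs" "ys \<noteq> []" "\<not> R (last ys) (hd ys)"
    proof (cases "length vs = 1")
      case True
      then obtain v where "vs = [v]"
        by (auto simp: length_Suc_conv)
      then have "us = xs" "v = hd xs"
        using uv(1) by auto
      then show ?thesis
        using that[of xs] xs uv \<open>vs = [v]\<close> by auto
    next
      case False
      then obtain ws where ws: "vs = ws @ [hd xs]" "ws \<noteq> []"
        using uv(1,3) by (cases vs rule: rev_cases) auto
      then have xs_eq: "xs = us @ ws"
        using uv(1) by simp
      then show ?thesis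
        using that[of "ws @ us"] xs uv ws cyclic_breaks_rotate[of R us ws] by auto
    qed
    define m where "m = length ys"
    have m: "card S = m" "m > 0"
      using ys(1,3) distinct_card[of ys] by (auto simp: m_def)
    define x where "x = hd ys"
    define z where "z = last ys"
    have x: "x = ys ! 0" and z: "z = ys ! (m - 1)"
      using ys(3) by (simp_all add: x_def z_def hd_conv_nth last_conv_nth m_def)
    \<comment> \<open>Both neighbourhoods are indexed by the pairs of positions \<open>i\<close>,
      \<open>Suc i\<close>: for \<open>I\<close> the right end is adjacent to the head
      \<open>x\<close>, for \<open>J\<close> the left end to the last element \<open>z\<close>.
      There are only \<open>m - 1\<close> such pairs, so the degree condition forces one in both
      sets.\<close>
    define I where "I = {i\<in>{..<m - 1}. R x (ys ! Suc i)}"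
    define J where "J = {i\<in>{..<m - 1}. R z (ys ! i)}"
    have nth_ys: "ys ! i \<in> S" if "i < m" for i
      using that ys(1) by (auto simp: m_def)
    have ex_nth: "\<exists>i<m. y = ys ! i" if "y \<in> S" for y
      using that ys(1) by (auto simp: in_set_conv_nth m_def)
    have "{y\<in>S. y \<noteq> x \<and> R x y} \<subseteq> (\<lambda>i. ys ! Suc i) ` I"
    proof
      fix y assume y: "y \<in> {y\<in>S. y \<noteq> x \<and> R x y}"
      then obtain i where i: "i < m" "y = ys ! i"
        using ex_nth by blast
      then have "i \<noteq> 0"
        using y x by (intro notI) auto
      then have "i - 1 \<in> I" "y = ys ! Suc (i - 1)"
        using i y by (auto simp: I_def)
      then show "y \<in> (\<lambda>i. ys ! Suc i) ` I"
        by blast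
    qed
    then have cI: "card {y\<in>S. y \<noteq> x \<and> R x y} \<le> card I"
      by (rule surj_card_le[rotated]) (simp add: I_def)
    have "{y\<in>S. y \<noteq> z \<and> R z y} \<subseteq> (\<lambda>i. ys ! i) ` J"
    proof
      fix y assume y: "y \<in> {y\<in>S. y \<noteq> z \<and> R z y}"
      then obtain i where i: "i < m" "y = ys ! i"
        using ex_nth by blast
      then have "i \<noteq> m - 1"
        using y z by (intro notI) auto
      then have "i \<in> J"
        using i y by (auto simp: J_def)
      then show "y \<in> (\<lambda>i. ys ! i) ` J"
        using i by blast
    qed
    then have cJ: "card {y\<in>S. y \<noteq> z \<and> R z y} \<le> card J"
      by (rule surj_card_le[rotated]) (simp add: J_def)
    have "x \<in> S" "z \<in> S"
      using nth_ys m x z by auto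
    then have "m \<le> card I + card J"
      using deg[of x] deg[of z] cI cJ m by linarith
    moreover have "card (I \<union> J) \<le> m - 1"
      using card_mono[of "{..<m - 1}" "I \<union> J"] by (auto simp: I_def J_def)
    moreover have "card I + card J = card (I \<union> J) + card (I \<inter> J)"
      by (rule card_Un_Int) (simp_all add: I_def J_def)
    ultimately have "card (I \<inter> J) \<noteq> 0"
      using m by linarith
    then have "I \<inter> J \<noteq> {}"
      by (metis card.empty)
    then obtain i where "i \<in> I" "i \<in> J"
      by blast
    then have i: "Suc i < m" "R x (ys ! Suc i)" "R z (ys ! i)"
      by (auto simp: I_def J_def)
    define as where "as = take (Suc i) ys"
    define bs where "bs = drop (Suc i) ys"
    have ab: "ys = as @ bs" "as \<noteq> []" "bs \<noteq> []"
      using i by (auto simp: as_def bs_def m_def)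
    have "last as = ys ! i"
      using i(1) by (simp add: as_def m_def take_Suc_conv_app_nth)
    moreover have "hd bs = ys ! Suc i"
      using i(1) by (simp add: bs_def m_def hd_drop_conv_nth)
    moreover have "last bs = z" "hd as = x"
      using ab by (simp_all add: z_def x_def)
    ultimately have ends: "last as = ys ! i" "hd bs = ys ! Suc i" "last bs = z" "hd as = x"
      by blast+
    have Rs: "R (last as) (last bs)" "R (hd bs) (hd as)"
      using i(2,3) ends R by (auto dest: sympD)
    \<comment> \<open>After reversing \<open>bs\<close>, the two joints are the adjacent pairs of
      \<open>Rs\<close>. The breaks inside the segments stay, and the break at the closing pair is
      gone.\<close>
    have "?P (as @ rev bs)"
      using ys(1) ab by auto
    then have "cyclic_breaks R ys \<le> cyclic_breaks R (as @ rev bs)"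
      using least ys(2) by simp
    moreover have "cyclic_breaks R (as @ rev bs) = breaks R as + breaks R bs"
      using ab Rs R by (simp add: cyclic_breaks_def breaks_append breaks_rev hd_rev last_rev)
    moreover have "cyclic_breaks R ys \<ge> breaks R as + breaks R bs + 1"
      using ab ys(4) by (simp add: cyclic_breaks_def breaks_append)
    ultimately show False
      by simp
  qed
  then show ?thesis
    using xs by (auto simp: cyclic_breaks_def breaks_eq_0_iff)
qed

text \<open>Missing at most three of the seven other vertices leaves degree at least four, half of
  eight.\<close>

lemma has_C8_dirac:
  assumes R: "symp R" and S: "card S = 8"
    and miss: "\<And>x. x \<in> S \<Longrightarrow> card {y\<in>S. y \<noteq> x \<and> \<not> R x y} \<le> 3"
  shows "has_C8 R S"
proof -
  have fS: "finite S"
    using S card.infinite by force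
  have "card S \<le> 2 * card {y\<in>S. y \<noteq> x \<and> R x y}" if "x \<in> S" for x
  proof -
    have "card (S - {x}) = card ({y\<in>S. y \<noteq> x \<and> \<not> R x y} \<union> {y\<in>S. y \<noteq> x \<and> R x y})"
      by (rule arg_cong[of _ _ card]) auto
    also have "\<dots> \<le> 3 + card {y\<in>S. y \<noteq> x \<and> R x y}"
      using card_Un_le miss[OF that] by (metis (no_types, lifting) add_le_mono1 le_trans)
    finally show ?thesis
      using S fS that by simp
  qed
  then obtain xs where "distinct xs" "set xs = S" "successively R (xs @ [hd xs])"
    using dirac[OF R fS] by blast
  then show ?thesis
    using S distinct_card unfolding has_C8_def by force
qed

section \<open>A Ramsey bound for a four-cycle against a triangle\<close>

text \<open>The non-neighbours of a vertex \<open>v\<close> form a clique, so there are at most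
  three of them. Its neighbours contain no path on three vertices, as \<open>v\<close> would close
  it to a four-cycle. An edge \<open>a\<close>, \<open>b\<close> among the neighbours then
  determines enough other adjacencies to produce a four-cycle.\<close>

lemma ex_C4_of_card_ge_7:
  assumes Q: "symp Q" and S: "7 \<le> card S"
    and indep: "\<And>x y z. {x, y, z} \<subseteq> S \<Longrightarrow> distinct [x, y, z] \<Longrightarrow> Q x y \<or> Q y z \<or> Q x z"
  shows "\<exists>a b c d. {a, b, c, d} \<subseteq> S \<and> distinct [a, b, c, d] \<and> Q a b \<and> Q b c \<and> Q c d \<and> Q d a"
proof (rule ccontr)
  assume no: "\<not> ?thesis"
  have C4: False if "{a, b, c, d} \<subseteq> S" "distinct [a, b, c, d]" "Q a b" "Q b c" "Q c d" "Q d a" for a b c d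
    using no that by blast
  have sym: "Q x y \<longleftrightarrow> Q y x" for x y
    using Q by (auto dest: sympD)
  have fS: "finite S"
    using S card.infinite by force
  obtain v where v: "v \<in> S"
    using S by fastforce
  define N where "N = {x\<in>S. x \<noteq> v \<and> Q v x}"
  define T where "T = {x\<in>S. x \<noteq> v \<and> \<not> Q v x}"
  have fin: "finite N" "finite T"
    using fS by (simp_all add: N_def T_def)
  have "card (N \<union> T) = card (S - {v})"
    by (rule arg_cong[of _ _ card]) (auto simp: N_def T_def)
  moreover have "N \<inter> T = {}"
    by (auto simp: N_def T_def)
  ultimately have NT: "card N + card T \<ge> 6"
    using card_Un_disjoint[OF fin] S v fS by simp
  have T_clique: "Q x y" if "x \<in> T" "y \<in> T" "x \<noteq> y" for x y
    using indep[of v x y] that v sym by (auto simp: T_def)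
  have T3: "card T \<le> 3"
  proof (rule ccontr)
    assume "\<not> card T \<le> 3"
    then obtain U where U: "U \<subseteq> T" "card U = 4"
      using obtain_subset_with_card_n[of 4 T] by auto
    then obtain a where "a \<in> U"
      by fastforce
    moreover obtain b where "b \<in> U" "b \<noteq> a"
      using ex_notin_if_card_less[of "{a}" U] U by auto
    ultimately obtain c d where "U = {a, b, c, d}" "distinct [a, b, c, d]"
      using card_4_obtain[OF U(2)] by metis
    moreover from this have "{a, b, c, d} \<subseteq> T"
      using U(1) by simp
    ultimately show False
      using C4[of a b c d] T_clique[of a b] T_clique[of b c] T_clique[of c d] T_clique[of d a]
      by (auto simp: T_def)
  qed
  then have "card N \<ge> 3"
    using NT by linarith
  then obtain W where W: "W \<subseteq> N" "card W = 3"
    using obtain_subset_with_card_n by metis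
  then obtain x y z where xyz: "{x, y, z} \<subseteq> N" "distinct [x, y, z]"
    by (auto simp: card_3_iff)
  have no_path: "\<not> Q y z" if "{x, y, z} \<subseteq> N" "distinct [x, y, z]" "Q x y" for x y z
    using that C4[of v x y z] v sym by (auto simp: N_def)
  obtain a b c where abc: "{a, b, c} \<subseteq> N" "distinct [a, b, c]" "Q a b"
    using indep[of x y z] xyz that[of x y z] that[of y z x] that[of x z y]
    by (auto simp: N_def)
  have ac: "\<not> Q p a \<and> \<not> Q p b" if "p \<in> N" "p \<noteq> a" "p \<noteq> b" for p
    using no_path[of a b p] no_path[of b a p] abc that sym by auto
  \<comment> \<open>Otherwise the triples \<open>t, a, p\<close> and \<open>t, b, p\<close> force
    \<open>t\<close> to be adjacent to \<open>a\<close> and \<open>b\<close>, and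
    \<open>t, a, v, b\<close> is a four-cycle.\<close>
  have Tp: "Q t p" if "t \<in> T" "p \<in> N" "p \<noteq> a" "p \<noteq> b" for t p
  proof (rule ccontr)
    assume "\<not> Q t p"
    moreover have "t \<noteq> a" "t \<noteq> b" "t \<noteq> p" "t \<in> S" "t \<noteq> v" "\<not> Q v t"
      using that abc by (auto simp: T_def N_def)
    ultimately have "Q t a" "Q t b"
      using indep[of t a p] indep[of t b p] ac[OF that(2-4)] that abc sym by (auto simp: N_def)
    then show False
      using C4[of t a v b] abc v sym \<open>t \<noteq> a\<close> \<open>t \<noteq> b\<close> \<open>t \<in> S\<close> \<open>t \<noteq> v\<close> by (auto simp: N_def)
  qed
  have cN: "c \<in> N" "c \<noteq> a" "c \<noteq> b" "a \<in> N" "b \<in> N"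
    using abc by auto
  show False
  proof (cases "card T = 3")
    case True
    then obtain s t u where stu: "T = {s, t, u}" "distinct [s, t, u]"
      by (auto simp: card_3_iff)
    then show False
      using C4[of c s t u] T_clique[of s t] T_clique[of t u] Tp[of s c] Tp[of u c] cN sym
      by (auto simp: T_def N_def)
  next
    case False
    then have "card N \<ge> 4"
      using T3 NT by linarith
    then obtain d where d: "d \<in> N" "d \<noteq> a" "d \<noteq> b" "d \<noteq> c"
      using ex_notin_if_card_less[of "{a, b, c}" N] abc(2) by auto
    have other: "Q x y" if "x \<in> N" "y \<in> N" "x \<noteq> y" "x \<notin> {a, b}" "y \<notin> {a, b}" for x y
      using indep[of a x y] ac that cN sym by (auto simp: N_def)
    show False
    proof (cases "T = {}")
      case True
      then have "card N \<ge> 5"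
        using NT by simp
      then obtain e where e: "e \<in> N" "e \<noteq> a" "e \<noteq> b" "e \<noteq> c" "e \<noteq> d"
        using ex_notin_if_card_less[of "{a, b, c, d}" N] abc(2) d by auto
      then show False
        using no_path[of c d e] other[of c d] other[of d e] d cN by auto
    next
      case False
      then obtain t where "t \<in> T"
        by blast
      then show False
        using C4[of t c v d] Tp[of t c] Tp[of t d] cN d v sym by (auto simp: T_def N_def)
    qed
  qed
qed

subsection \<open>Counterexamples to the upper bound\<close>

text \<open>In \<open>no_tree\<close>, \<open>v\<close> and \<open>w\<close> are the centers of the two stars of \<open>S\<^sub>n[5]\<close> and \<open>L\<close> consists of
  the leaves at \<open>w\<close>; in \<open>no_wheel\<close>, \<open>h\<close> is the hub of a \<open>W\<^sub>8\<close> in the complement.\<close>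

locale ramsey_counterexample =
  fixes V :: "'a set" and E :: "'a \<Rightarrow> 'a \<Rightarrow> bool" and n :: nat
  assumes finite_V: "finite V" and E_sym: "E x y \<Longrightarrow> E y x" and E_V: "E x y \<Longrightarrow> x \<in> V"
    and E_irrefl: "\<not> E x x"
    and n: "9 \<le> n" and card_V: "card V = 2 * n - 1"
    and no_tree: "\<lbrakk>v \<noteq> w; E v u; E w u; L \<subseteq> {y. E w y} - {v, u}; card L = 3\<rbrakk>
          \<Longrightarrow> card ({y. E v y} - ({u, w} \<union> L)) < n - 6"
    and no_wheel: "h \<in> V \<Longrightarrow> \<not> has_C8 (\<lambda>x y. x \<noteq> y \<and> \<not> E x y) {y\<in>V. y \<noteq> h \<and> \<not> E h y}"
begin

abbreviation N :: "'a \<Rightarrow> 'a set" where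
  "N x \<equiv> {y. E x y}"

abbreviation M :: "'a \<Rightarrow> 'a set" where
  "M x \<equiv> {y\<in>V. y \<noteq> x \<and> \<not> E x y}"

lemma symp_nonadjacent: "symp (\<lambda>x y. x \<noteq> y \<and> \<not> E x y)"
  using E_sym by (auto simp: symp_def)

lemma E_comm: "E x y \<longleftrightarrow> E y x"
  using E_sym by blast

lemma N_subset: "N x \<subseteq> V"
  using E_V E_sym by blast

lemma finite_N: "finite (N x)"
  using N_subset finite_V by (rule finite_subset)

lemma finite_M: "finite (M x)"
  using finite_V by simp

lemma card_split:
  assumes "x \<in> V" "T \<subseteq> V"
  shows "card T = card (T \<inter> N x) + card (T \<inter> M x) + (if x \<in> T then 1 else 0)"
proof -
  have fT: "finite T"
    using assms(2) finite_V by (rule finite_subset)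
  have "T = (T \<inter> N x) \<union> (T \<inter> M x) \<union> (T \<inter> {x})"
    using assms by auto
  then have "card T = card ((T \<inter> N x) \<union> (T \<inter> M x) \<union> (T \<inter> {x}))"
    by simp
  also have "\<dots> = card ((T \<inter> N x) \<union> (T \<inter> M x)) + card (T \<inter> {x})"
    using fT E_irrefl by (intro card_Un_disjoint) auto
  also have "card ((T \<inter> N x) \<union> (T \<inter> M x)) = card (T \<inter> N x) + card (T \<inter> M x)"
    using fT by (intro card_Un_disjoint) auto
  finally show ?thesis
    by simp
qed

lemma card_N_M:
  assumes "x \<in> V"
  shows "card (N x) + card (M x) = 2 * n - 2"
proof -
  have "V \<inter> N x = N x" "V \<inter> M x = M x"
    using N_subset by auto
  then show ?thesis
    using card_split[OF assms order_refl] assms card_V by simp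
qed

section \<open>Conditions that force a wheel or a tree\<close>

text \<open>The rim alternates between \<open>Z\<close> and \<open>Y\<close> in the complement,
  where a miss is an edge of \<open>E\<close>. With \<open>m = 0\<close> four vertices on each side
  suffice.\<close>

lemma no_bipartite:
  assumes h: "h \<in> V" and Z: "Z \<subseteq> M h" "4 \<le> card Z" and Y: "Y \<subseteq> M h" "Z \<inter> Y = {}"
    and miss: "\<And>z. z \<in> Z \<Longrightarrow> card (Y \<inter> N z) \<le> m"
    and m: "m + 4 \<le> card Y" "2 * m + 2 \<le> card Y"
  shows False
proof -
  obtain Z' where Z': "Z' \<subseteq> Z" "card Z' = 4"
    using obtain_subset_with_card_n[OF Z(2)] by blast
  have "{y\<in>Y. \<not> (z \<noteq> y \<and> \<not> E z y)} = Y \<inter> N z" if "z \<in> Z'" for z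
    using that Z' Y(2) by auto
  then have "has_C8 (\<lambda>x y. x \<noteq> y \<and> \<not> E x y) (Z' \<union> Y)"
    using Z' Y miss m finite_subset[OF Y(1) finite_M]
    by (intro has_C8_bipartite[where m = m] symp_nonadjacent) auto
  then have "has_C8 (\<lambda>x y. x \<noteq> y \<and> \<not> E x y) (M h)"
    by (rule has_C8_mono) (use Z Z' Y in blast)
  then show False
    using no_wheel[OF h] by simp
qed

lemma no_dirac:
  assumes h: "h \<in> V" and S: "S \<subseteq> M h" "8 \<le> card S"
    and miss: "\<And>x. x \<in> S \<Longrightarrow> card (S \<inter> N x) \<le> 3"
  shows False
proof -
  obtain S' where S': "S' \<subseteq> S" "card S' = 8"
    using obtain_subset_with_card_n[OF S(2)] by blast
  have "card {y\<in>S'. y \<noteq> x \<and> \<not> (x \<noteq> y \<and> \<not> E x y)} \<le> 3" if "x \<in> S'" for x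
  proof -
    have "card {y\<in>S'. y \<noteq> x \<and> \<not> (x \<noteq> y \<and> \<not> E x y)} \<le> card (S \<inter> N x)"
      using S' finite_subset[OF S(1) finite_M] by (intro card_mono) auto
    then show ?thesis
      using miss[of x] that S'(1) by auto
  qed
  then have "has_C8 (\<lambda>x y. x \<noteq> y \<and> \<not> E x y) S'"
    using S'(2) by (intro has_C8_dirac symp_nonadjacent)
  then have "has_C8 (\<lambda>x y. x \<noteq> y \<and> \<not> E x y) (M h)"
    by (rule has_C8_mono) (use S S' in blast)
  then show False
    using no_wheel[OF h] by simp
qed

text \<open>The leaves at \<open>w\<close> are taken outside \<open>N v\<close> as far as possible,
  since only leaves inside \<open>N v\<close> are lost to the star at \<open>v\<close>. The two
  bounds in \<open>D\<close> cover the cases of fewer than three and of three outside leaves; an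
  edge between \<open>v\<close> and \<open>w\<close> costs one more neighbour of
  \<open>v\<close>.\<close>

lemma tree_at:
  assumes "v \<noteq> w" and C: "N v \<inter> N w \<noteq> {}"
    and kl: "4 \<le> card (N v \<inter> N w) + card (M v \<inter> N w)"
    and D: "n - 2 + (if E v w then 1 else 0) \<le> card (N v) + card (M v \<inter> N w)"
      "n - 5 + (if E v w then 1 else 0) \<le> card (N v)"
  shows False
proof -
  define l where "l = min (card (M v \<inter> N w)) 3"
  obtain u where u: "E v u" "E w u"
    using C by blast
  have "l \<le> card (M v \<inter> N w)"
    by (simp add: l_def)
  then obtain L1 where L1: "L1 \<subseteq> M v \<inter> N w" "card L1 = l"
    by (rule obtain_subset_with_card_n)
  have "card (N v \<inter> N w - {u}) = card (N v \<inter> N w) - 1"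
    using u by simp
  moreover have "card (N v \<inter> N w) > 0"
    using C finite_N by (simp add: card_gt_0_iff)
  ultimately have "3 - l \<le> card (N v \<inter> N w - {u})"
    using kl by (simp add: l_def)
  then obtain L2 where L2: "L2 \<subseteq> N v \<inter> N w - {u}" "card L2 = 3 - l"
    by (rule obtain_subset_with_card_n)
  have fin: "finite L1" "finite L2"
    using L1 L2 finite_N[of v] finite_M[of v] by (auto intro: finite_subset)
  have "card (L1 \<union> L2) = card L1 + card L2"
    using fin L1 L2 by (intro card_Un_disjoint) auto
  then have L: "card (L1 \<union> L2) = 3"
    using L1 L2 by (simp add: l_def)
  have "L1 \<union> L2 \<subseteq> N w - {v, u}"
    using L1 L2 u E_irrefl by blast
  then have less: "card (N v - ({u, w} \<union> (L1 \<union> L2))) < n - 6"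
    using no_tree[OF assms(1) u _ L] by blast
  \<comment> \<open>\<open>X\<close> is the part of \<open>N v\<close> used up by \<open>u\<close>,
    \<open>w\<close> and the leaves at \<open>w\<close>; \<open>L1\<close> lies outside
    \<open>N v\<close>.\<close>
  define X where "X = insert u L2 \<union> (if E v w then {w} else {})"
  have "N v - ({u, w} \<union> (L1 \<union> L2)) = N v - X"
    using L1 by (auto simp: X_def)
  moreover have "card X \<le> 1 + card L2 + (if E v w then 1 else 0)"
    unfolding X_def using card_Un_le[of "insert u L2" "if E v w then {w} else {}"] fin
    by (auto simp: card_insert_if split: if_splits)
  moreover have "card (N v) - card X \<le> card (N v - X)"
    using fin by (intro diff_card_le_card_Diff) (auto simp: X_def)
  ultimately show False
    using less D L2(2) n by (auto simp: l_def min_def split: if_splits)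
qed

text \<open>For an arbitrary centre \<open>v\<close>, its at most three non-neighbours
  \<open>P\<close> have to hang at the other centre. So it is enough to find a \<open>w\<close>
  adjacent to all of \<open>P\<close> except possibly itself.\<close>

lemma spanning_tree:
  assumes S: "S \<subseteq> V" "n \<le> card S" and miss: "\<And>x. x \<in> S \<Longrightarrow> card (S \<inter> M x) \<le> 3"
  shows False
proof -
  obtain T where T: "T \<subseteq> S" "card T = n"
    using obtain_subset_with_card_n[OF S(2)] by blast
  have TV: "T \<subseteq> V" and fT: "finite T"
    using T S(1) finite_V by (auto intro: finite_subset)
  have missT: "card (T \<inter> M x) \<le> 3" if "x \<in> T" for x
  proof -
    have "card (T \<inter> M x) \<le> card (S \<inter> M x)"
      using T finite_M by (intro card_mono) auto
    then show ?thesis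
      using miss[of x] that T by auto
  qed
  have degT: "n - 4 \<le> card (T \<inter> N x)" if "x \<in> T" for x
    using card_split[of x T] missT[OF that] that TV T(2) by auto
  obtain v where v: "v \<in> T"
    using T(2) n by fastforce
  define P where "P = T \<inter> M v"
  have P3: "card P \<le> 3" and fP: "finite P"
    using missT[OF v] fT by (simp_all add: P_def)
  obtain w where w: "w \<in> T" "w \<noteq> v" "P \<subseteq> insert w (N w)"
  proof (cases "\<exists>p\<in>P. P \<inter> M p = {}")
    case True
    then obtain p where "p \<in> P" "P \<inter> M p = {}"
      by blast
    then show ?thesis
      using that[of p] TV by (auto simp: P_def)
  next
    case False
    \<comment> \<open>Here \<open>p\<close> misses both \<open>v\<close> and some \<open>q\<close>
      in \<open>P\<close>, so at most one miss lies elsewhere. Thus at most three candidates for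
      \<open>w\<close> are spoiled, out of at least five.\<close>
    have le1: "card (T \<inter> M p - P - {v}) \<le> 1" if "p \<in> P" for p
    proof -
      have "P \<inter> M p \<noteq> {}"
        using bexI[OF _ that] False by fast
      then obtain q where "q \<in> P" "q \<in> M p"
        by auto
      then have "q \<in> T \<inter> M p" "v \<in> T \<inter> M p" "q \<noteq> v" "q \<in> P"
        using that v TV E_comm by (auto simp: P_def)
      then have "card (T \<inter> M p - P - {v}) \<le> card (T \<inter> M p - {q, v})"
        using fT by (intro card_mono) auto
      also have "\<dots> = card (T \<inter> M p) - 2"
        using \<open>q \<in> T \<inter> M p\<close> \<open>v \<in> T \<inter> M p\<close> \<open>q \<noteq> v\<close> by (subst card_Diff_subset) auto
      finally show ?thesis
        using missT[of p] that by (auto simp: P_def)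
    qed
    define B where "B = (\<Union>p\<in>P. T \<inter> M p - P - {v})"
    have "card B \<le> (\<Sum>p\<in>P. card (T \<inter> M p - P - {v}))"
      unfolding B_def using fP by (rule card_UN_le)
    also have "\<dots> \<le> card P * 1"
      using sum_bounded_above[of P "\<lambda>p. card (T \<inter> M p - P - {v})" 1] le1 by simp
    finally have "card B \<le> 3"
      using P3 by simp
    moreover have "card (T - insert v P) \<ge> n - 4"
      using diff_card_le_card_Diff[of "insert v P" T] fP T(2) P3
      by (auto simp: card_insert_if split: if_splits)
    ultimately have "card B < card (T - insert v P)"
      using n by linarith
    moreover have "finite B"
      using fP fT by (simp add: B_def)
    ultimately obtain w where w: "w \<in> T - insert v P" "w \<notin> B"
      using ex_notin_if_card_less by blast
    moreover have "E w p" if "p \<in> P" for p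
    proof (rule ccontr)
      assume "\<not> E w p"
      then have "w \<in> M p"
        using w that TV E_comm by auto
      then show False
        using w that by (auto simp: B_def)
    qed
    ultimately show ?thesis
      using that[of w] by auto
  qed
  define G where "G = T \<inter> N w - {v}"
  have G: "4 \<le> card G" "finite G"
    using degT[OF w(1)] n fT by (auto simp: G_def card_Diff_singleton_if)
  have "P - {w} \<subseteq> G"
    using w by (auto simp: P_def G_def)
  moreover have "card (P - {w}) \<le> 3"
    using card_mono[OF fP, of "P - {w}"] P3 by auto
  \<comment> \<open>Once \<open>L\<close> contains \<open>P - {w}\<close>, every vertex of
    \<open>T\<close> outside \<open>L\<close> other than \<open>v\<close> and \<open>w\<close> is
    adjacent to \<open>v\<close>.\<close>
  ultimately obtain L where L: "P - {w} \<subseteq> L" "L \<subseteq> G" "card L = 3"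
    using exists_subset_between[of "P - {w}" 3 G] G by auto
  have fL: "finite L"
    using L(2) G(2) by (rule finite_subset)
  obtain u where u: "u \<in> G" "u \<notin> L"
    using ex_notin_if_card_less[of L G] L(3) G(1) fL by auto
  have Ev: "E v x" if "x \<in> T" "x \<noteq> v" "x \<noteq> w" "x \<notin> L" for x
    using that L(1) TV by (auto simp: P_def)
  have "E w u" "E v u"
    using u Ev[of u] E_irrefl by (auto simp: G_def)
  then have "card (N v - ({u, w} \<union> L)) < n - 6"
    using L u w by (intro no_tree) (auto simp: G_def)
  moreover have "T - ({v, u, w} \<union> L) \<subseteq> N v - ({u, w} \<union> L)"
    using Ev by auto
  then have "card (T - ({v, u, w} \<union> L)) \<le> card (N v - ({u, w} \<union> L))"
    using finite_N by (intro card_mono) auto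
  moreover have "card ({v, u, w} \<union> L) \<le> 6"
    using card_Un_le[of "{v, u, w}" L] L(3) card_insert_le_m1[of 3 "{u, w}" v]
    by (auto simp: card_insert_if split: if_splits)
  moreover have "card T - card ({v, u, w} \<union> L) \<le> card (T - ({v, u, w} \<union> L))"
    using fL by (intro diff_card_le_card_Diff) auto
  ultimately show False
    using T(2) by linarith
qed

section \<open>Excluding degrees of at least \<open>n - 5\<close>\<close>

text \<open>At degree \<open>n - 1\<close> or more, \<open>tree_at\<close> leaves every vertex that
  shares a neighbour with \<open>v\<close> at most three neighbours besides \<open>v\<close>.
  Dirac's theorem then finds a rim inside \<open>N v\<close> or, around a hub in \<open>M v\<close>,
  across \<open>N v\<close> and \<open>M v\<close>.\<close>

lemma degree_less:
  assumes v: "v \<in> V"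
  shows "card (N v) < n - 1"
proof (rule ccontr)
  assume "\<not> card (N v) < n - 1"
  then have D: "n - 1 \<le> card (N v)"
    by simp
  have few: "card (N v \<inter> N w) + card (M v \<inter> N w) \<le> 3" if "w \<noteq> v" "N v \<inter> N w \<noteq> {}" for w
  proof (rule ccontr)
    assume "\<not> card (N v \<inter> N w) + card (M v \<inter> N w) \<le> 3"
    then show False
      using that D n by (intro tree_at[of v w]) auto
  qed
  have few': "card (N v \<inter> N w) \<le> 3" if "w \<noteq> v" for w
    using few[OF that] by (cases "N v \<inter> N w = {}") auto
  have in_N: "x \<in> V" "x \<noteq> v" if "x \<in> N v" for x
    using that E_V E_sym E_irrefl by auto
  have large: "card (N v \<inter> M h) < 8" if h: "h \<in> V" for h
  proof (rule ccontr)
    assume "\<not> card (N v \<inter> M h) < 8"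
    moreover have "card (N v \<inter> M h \<inter> N x) \<le> 3" if "x \<in> N v \<inter> M h" for x
    proof -
      have "card (N v \<inter> M h \<inter> N x) \<le> card (N v \<inter> N x)"
        using finite_N by (intro card_mono) auto
      then show ?thesis
        using few'[of x] in_N[of x] that by auto
    qed
    ultimately show False
      using no_dirac[OF h, of "N v \<inter> M h"] by fastforce
  qed
  have card_NM: "card (N v) - 4 \<le> card (N v \<inter> M h)" if "h \<in> V" "h \<noteq> v" for h
    using card_split[OF that(1) N_subset, of v] few'[OF that(2)] by auto
  show False
  proof (cases "M v = {}")
    case True
    then have "card (N v) = 2 * n - 2"
      using card_N_M[OF v] by (metis add.right_neutral card.empty)
    moreover from this obtain a where a: "a \<in> N v"
      using n by fastforce
    ultimately show False
      using card_NM[of a] large[of a] in_N[OF a] n by simp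
  next
    case False
    then obtain p where p: "p \<in> M v"
      by blast
    have p': "p \<in> V" "p \<noteq> v" "p \<notin> N v"
      using p by auto
    have card_A: "card (N v) = card (N v \<inter> N p) + card (N v \<inter> M p)"
      using card_split[OF p'(1) N_subset, of v] p'(3) by simp
    have "N v \<inter> N p \<noteq> {}"
    proof
      assume "N v \<inter> N p = {}"
      then have "card (N v) = card (N v \<inter> M p)"
        using card_A by simp
      then show False
        using large[OF p'(1)] D n by linarith
    qed
    then have kl: "card (N v \<inter> N p) + card (M v \<inter> N p) \<le> 3" and k: "card (N v \<inter> N p) \<ge> 1"
      using few[of p] p' finite_N by (auto simp: Suc_le_eq card_gt_0_iff)
    have "card (M v) = card (M v \<inter> N p) + card (M v \<inter> M p) + 1"
      using card_split[OF p'(1), of "M v"] p by auto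
    then have 3: "3 \<le> card (M v \<inter> M p)" and 5: "5 \<le> card (N v \<inter> M p)"
      using large[OF p'(1)] card_A kl k card_N_M[OF v] D n by linarith+
    \<comment> \<open>The split into five and three matters: a vertex without common neighbour with
      \<open>v\<close> is adjacent to nothing in \<open>S1\<close>, and \<open>S2\<close> has only
      three elements.\<close>
    obtain S1 where S1: "S1 \<subseteq> N v \<inter> M p" "card S1 = 5"
      using 5 by (rule obtain_subset_with_card_n)
    obtain S2 where S2: "S2 \<subseteq> M v \<inter> M p" "card S2 = 3"
      using 3 by (rule obtain_subset_with_card_n)
    have fin: "finite S1" "finite S2"
      using S1 S2 finite_M[of p] by (auto intro: finite_subset)
    have "card (S1 \<union> S2) = 8"
      using card_Un_disjoint[OF fin] S1 S2 by auto
    moreover have "S1 \<union> S2 \<subseteq> M p"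
      using S1(1) S2(1) by blast
    moreover have "card ((S1 \<union> S2) \<inter> N x) \<le> 3" if x: "x \<in> S1 \<union> S2" for x
    proof -
      have xv: "x \<noteq> v"
        using x S1 S2 E_irrefl by auto
      show ?thesis
      proof (cases "N v \<inter> N x = {}")
        case True
        then have "card ((S1 \<union> S2) \<inter> N x) \<le> card S2"
          using fin S1(1) by (intro card_mono) auto
        then show ?thesis
          using S2(2) by simp
      next
        case False
        have "card ((S1 \<union> S2) \<inter> N x) \<le> card ((N v \<inter> N x) \<union> (M v \<inter> N x))"
          using finite_N S1(1) S2(1) by (intro card_mono) auto
        then show ?thesis
          using few[OF xv False] card_Un_le[of "N v \<inter> N x" "M v \<inter> N x"] by linarith
      qed
    qed
    ultimately show False
      using no_dirac[OF p'(1), of "S1 \<union> S2"] by simp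
  qed
qed

text \<open>At this degree an edge from \<open>v\<close> to \<open>a\<close> must be paid for by a
  neighbour of \<open>a\<close> in \<open>M v\<close>, hence the extra premise of
  \<open>fewA\<close>. The vertices of \<open>U1\<close> turn out to be adjacent to all of
  \<open>M v - U1\<close>, which leaves only \<open>n = 9\<close> and \<open>card U1 = 7\<close>;
  there the two vertices of \<open>M v - U1\<close> are the centres of a tree.\<close>

lemma degree_neq:
  assumes v: "v \<in> V"
  shows "card (N v) \<noteq> n - 2"
proof
  assume D: "card (N v) = n - 2"
  have cU: "card (M v) = n"
    using card_N_M[OF v] D n by simp
  have fewU: "card (N v \<inter> N w) + card (M v \<inter> N w) \<le> 3" if "w \<in> M v" "N v \<inter> N w \<noteq> {}" for w
  proof (rule ccontr)
    assume "\<not> card (N v \<inter> N w) + card (M v \<inter> N w) \<le> 3"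
    then show False
      using that D n by (intro tree_at[of v w]) auto
  qed
  have fewA: "card (N v \<inter> N a) + card (M v \<inter> N a) \<le> 3"
    if "a \<in> N v" "N v \<inter> N a \<noteq> {}" "M v \<inter> N a \<noteq> {}" for a
  proof (rule ccontr)
    assume *: "\<not> card (N v \<inter> N a) + card (M v \<inter> N a) \<le> 3"
    have "a \<noteq> v"
      using that(1) E_irrefl by auto
    moreover have "card (M v \<inter> N a) > 0"
      using that(3) finite_N by (simp add: card_gt_0_iff)
    ultimately show False
      using that(1,2) * D n by (intro tree_at[of v a]) auto
  qed
  define U1 where "U1 = {w\<in>M v. N v \<inter> N w \<noteq> {}}"
  have fU1: "finite U1"
    using finite_V by (simp add: U1_def)
  have U0: "E x y \<Longrightarrow> False" if "x \<in> N v" "y \<in> M v - U1" for x y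
    using that E_comm by (auto simp: U1_def)
  have l2: "card (M v \<inter> N p) \<le> 2" and k3: "card (N v \<inter> N p) \<le> 3" if "p \<in> U1" for p
  proof -
    have "card (N v \<inter> N p) > 0"
      using that finite_N by (simp add: U1_def card_gt_0_iff)
    then show "card (M v \<inter> N p) \<le> 2" "card (N v \<inter> N p) \<le> 3"
      using fewU[of p] that by (auto simp: U1_def)
  qed
  \<comment> \<open>If no edge joins \<open>N v\<close> to \<open>M v\<close>, four complement
    neighbours of \<open>y\<close> in \<open>M v\<close> give a rim with \<open>N v\<close> around
    the hub \<open>y\<close>. Otherwise the \<open>n\<close> vertices of \<open>M v\<close> span the
    tree.\<close>
  have "U1 \<noteq> {}"
  proof
    assume empty: "U1 = {}"
    have "card (M v \<inter> M y) \<le> 3" if y: "y \<in> M v" for y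
    proof (rule ccontr)
      assume "\<not> card (M v \<inter> M y) \<le> 3"
      moreover have "N v \<subseteq> M y"
        using y U0[of _ y] empty N_subset[of v] by (auto dest: E_sym)
      moreover have "N v \<inter> N z = {}" if "z \<in> M v \<inter> M y" for z
        using that empty by (auto simp: U1_def)
      ultimately show False
        using y D n by (intro no_bipartite[of y "M v \<inter> M y" "N v" 0]) auto
    qed
    then show False
      using cU by (intro spanning_tree[of "M v"]) auto
  qed
  have indep: "M v \<inter> M p \<subseteq> U1" if p: "p \<in> U1" for p
  proof (rule ccontr)
    assume "\<not> M v \<inter> M p \<subseteq> U1"
    then obtain y where y: "y \<in> M v \<inter> M p" "y \<notin> U1"
      by blast
    have p': "p \<in> V" "p \<in> M v" "p \<notin> N v"
      using p by (auto simp: U1_def)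
    have "card (N v) = card (N v \<inter> N p) + card (N v \<inter> M p)"
      using card_split[OF p'(1) N_subset, of v] p'(3) by simp
    then have "4 \<le> card (N v \<inter> M p)"
      using k3[OF p] D n by linarith
    then obtain S1 where S1: "S1 \<subseteq> N v \<inter> M p" "card S1 = 4"
      by (rule obtain_subset_with_card_n)
    have "card (M v) = card (M v \<inter> N p) + card (M v \<inter> M p) + 1"
      using card_split[OF p'(1), of "M v"] p'(2) by auto
    then have "4 \<le> card (M v \<inter> M p)"
      using l2[OF p] cU n by linarith
    \<comment> \<open>\<open>y\<close> has no neighbour in \<open>N v\<close>, so including it gives
      every vertex of \<open>S1\<close> a non-neighbour in \<open>S2\<close>.\<close>
    then obtain S2 where S2: "{y} \<subseteq> S2" "S2 \<subseteq> M v \<inter> M p" "card S2 = 4"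
      using exists_subset_between[of "{y}" 4 "M v \<inter> M p"] y(1) finite_M[of p] by auto
    have fin: "finite S1" "finite S2"
      using S1 S2 finite_M[of p] by (auto intro: finite_subset)
    have "card (S1 \<union> S2) = 8"
      using card_Un_disjoint[OF fin] S1 S2 by auto
    moreover have "S1 \<union> S2 \<subseteq> M p"
      using S1(1) S2(2) by blast
    moreover have "card ((S1 \<union> S2) \<inter> N x) \<le> 3" if x: "x \<in> S1 \<union> S2" for x
    proof -
      consider "N v \<inter> N x = {}" | "x \<in> S1" "M v \<inter> N x = {}" | "card (N v \<inter> N x) + card (M v \<inter> N x) \<le> 3"
        using x S1(1) S2(2) fewA[of x] fewU[of x] by blast
      then show ?thesis
      proof cases
        case 1
        define z where "z = (if x \<in> S2 then x else y)"
        have z: "z \<in> S2" "z \<notin> N x"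
          using x S1(1) S2 y E_irrefl E_comm[of x y] U0[of x y] by (auto simp: z_def)
        have "card ((S1 \<union> S2) \<inter> N x) \<le> card (S2 - {z})"
          using fin S1(1) 1 z by (intro card_mono) auto
        then show ?thesis
          using S2(3) z by simp
      next
        case 2
        have "card ((S1 \<union> S2) \<inter> N x) \<le> card (S1 - {x})"
          using fin S2(2) 2 E_irrefl by (intro card_mono) auto
        then show ?thesis
          using S1(2) 2 by simp
      next
        case 3
        have "card ((S1 \<union> S2) \<inter> N x) \<le> card ((N v \<inter> N x) \<union> (M v \<inter> N x))"
          using finite_N S1(1) S2(2) by (intro card_mono) auto
        then show ?thesis
          using 3 card_Un_le[of "N v \<inter> N x" "M v \<inter> N x"] by linarith
      qed
    qed
    ultimately show False
      using no_dirac[OF p'(1), of "S1 \<union> S2"] by simp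
  qed
  have adj: "E p y" if "p \<in> U1" "y \<in> M v - U1" for p y
    using indep[OF that(1)] that by (auto simp: U1_def)
  obtain p where p: "p \<in> U1"
    using \<open>U1 \<noteq> {}\<close> by blast
  have "card (M v - U1) \<le> card (M v \<inter> N p)"
    using adj[OF p] finite_N by (intro card_mono) auto
  then have U0_2: "card (M v - U1) \<le> 2"
    using l2[OF p] by simp
  have "U1 \<subseteq> M v"
    by (auto simp: U1_def)
  then have cU1: "card U1 + card (M v - U1) = n"
    using cU card_Diff_subset[OF fU1] card_mono[OF finite_M, of U1 v] by simp
  have "card U1 < 8"
  proof (rule ccontr)
    assume "\<not> card U1 < 8"
    moreover have "card (U1 \<inter> N x) \<le> 3" if "x \<in> U1" for x
    proof -
      have "card (U1 \<inter> N x) \<le> card (M v \<inter> N x)"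
        using finite_N by (intro card_mono) (auto simp: U1_def)
      then show ?thesis
        using l2[OF that] by simp
    qed
    ultimately show False
      using no_dirac[OF v, of U1] \<open>U1 \<subseteq> M v\<close> by simp
  qed
  then have n9: "n = 9" "card U1 = 7" "card (M v - U1) = 2"
    using U0_2 cU1 n by linarith+
  then obtain y z where yz: "M v - U1 = {y, z}" "y \<noteq> z"
    by (auto simp: card_2_iff)
  have sub: "U1 \<subseteq> N y \<inter> N z"
    using adj yz E_comm by blast
  have 7: "7 \<le> card (N y \<inter> N z)"
    using card_mono[OF _ sub] finite_N n9 by simp
  have "U1 \<union> (if E y z then {z} else {}) \<subseteq> N y"
    using sub by auto
  then have "card (U1 \<union> (if E y z then {z} else {})) \<le> card (N y)"
    using finite_N by (intro card_mono)
  moreover have "z \<notin> U1"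
    using yz by blast
  ultimately have "7 + (if E y z then 1 else 0) \<le> card (N y)"
    using n9 fU1 by (auto split: if_splits)
  moreover have "N y \<inter> N z \<noteq> {}"
    using 7 by (metis card.empty not_numeral_le_zero)
  ultimately show False
    using yz 7 n9 by (intro tree_at[of y z]) auto
qed

text \<open>Vertices of \<open>U1\<close> have few neighbours in \<open>M v\<close>, so
  \<open>U1\<close> is small and the complement is nearly complete bipartite between
  \<open>U0\<close> and \<open>B \<union> U1\<close>. One side has at least \<open>n\<close> of the
  \<open>2 * n - 1\<close> vertices, and \<open>spanning_tree\<close> applies to it.\<close>

lemma degree_not_between:
  assumes v: "v \<in> V" and D: "n - 5 \<le> card (N v)" "card (N v) \<le> n - 3"
  shows False
proof -
  have cU: "card (N v) + card (M v) = 2 * n - 2"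
    using card_N_M[OF v] .
  define U1 where "U1 = {w\<in>M v. N v \<inter> N w \<noteq> {}}"
  have fU1: "finite U1" and U1M: "U1 \<subseteq> M v"
    using finite_V by (auto simp: U1_def)
  have k1: "1 \<le> card (N v \<inter> N w)" if "w \<in> U1" for w
    using that finite_N by (simp add: U1_def Suc_le_eq card_gt_0_iff)
  have l2: "card (M v \<inter> N w) \<le> 2" if "w \<in> U1" for w
  proof (rule ccontr)
    assume "\<not> card (M v \<inter> N w) \<le> 2"
    then show False
      using that k1[OF that] D n by (intro tree_at[of v w]) (auto simp: U1_def)
  qed
  have U1_3: "card U1 \<le> 3"
  proof (rule ccontr)
    assume "\<not> card U1 \<le> 3"
    then have "4 \<le> card U1"
      by simp
    then obtain Z where Z: "Z \<subseteq> U1" "card Z = 4" "finite Z"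
      by (rule obtain_subset_with_card_n)
    have ZM: "Z \<subseteq> M v"
      using Z(1) U1M by (rule subset_trans)
    \<comment> \<open>At least \<open>n - 3 \<ge> 6\<close> vertices remain, and six is what
      \<open>no_bipartite\<close> asks for with two misses per vertex.\<close>
    have cY: "card (M v - Z) = card (M v) - 4"
      using card_Diff_subset[OF Z(3) ZM] Z(2) by simp
    have "card ((M v - Z) \<inter> N z) \<le> 2" if "z \<in> Z" for z
    proof -
      have "card ((M v - Z) \<inter> N z) \<le> card (M v \<inter> N z)"
        using finite_N by (intro card_mono) auto
      then show ?thesis
        using l2[of z] that Z(1) by auto
    qed
    then show False
      using ZM Z(2) cY cU D n by (intro no_bipartite[OF v, of Z "M v - Z" 2]) auto
  qed
  define U0 where "U0 = M v - U1"
  define B where "B = insert v (N v)"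
  have BV: "B \<subseteq> V" and fB: "finite B" and cB: "card B = card (N v) + 1"
    using v N_subset finite_N E_irrefl by (auto simp: B_def)
  have U0V: "U0 \<subseteq> V" "U0 \<subseteq> M v" and fU0: "finite U0"
    using finite_V by (auto simp: U0_def)
  have cU0: "card U0 + card U1 = card (M v)"
    using card_Diff_subset[OF fU1 U1M] card_mono[OF finite_M U1M] by (simp add: U0_def)
  have nonadj: "\<not> E y b" "y \<noteq> b" if "y \<in> U0" "b \<in> B" for y b
    using that E_comm by (auto simp: U0_def U1_def B_def)
  have BM: "B \<subseteq> M y" if "y \<in> U0" for y
    using nonadj[OF that] BV by blast
  have U0_miss: "card (U0 \<inter> M y) \<le> 3" if y: "y \<in> U0" for y
  proof (rule ccontr)
    assume "\<not> card (U0 \<inter> M y) \<le> 3"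
    moreover have "card (B \<inter> N z) \<le> 0" if "z \<in> U0 \<inter> M y" for z
    proof -
      have "B \<inter> N z = {}"
        using nonadj that by blast
      then show ?thesis
        by simp
    qed
    moreover have "U0 \<inter> M y \<inter> B = {}"
      using nonadj by blast
    ultimately show False
      using y U0V BM[OF y] cB D n by (intro no_bipartite[of y "U0 \<inter> M y" B 0]) auto
  qed
  have U0_less: "card U0 < n"
  proof (rule ccontr)
    assume "\<not> card U0 < n"
    then show False
      using U0_miss U0V by (intro spanning_tree[of U0]) auto
  qed
  \<comment> \<open>Degree \<open>n - 5\<close> would leave at least \<open>n\<close> vertices in
    \<open>U0\<close>.\<close>
  have U0_7: "7 \<le> card U0" and D4: "n - 4 \<le> card (N v)"
    using U1_3 cU0 cU D n U0_less by linarith+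
  have BU1: "B \<inter> U1 = {}"
    using U1M by (auto simp: B_def)
  have U0_N: "U0 \<inter> N p \<subseteq> M v \<inter> N p" for p
    using U0V by blast
  have BU0: "B \<inter> U0 = {}" and U1U0: "U1 \<inter> U0 = {}"
    by (auto simp: B_def U0_def)
  have PV: "B \<union> U1 \<subseteq> V" "(B \<union> U1) \<inter> U0 = {}"
    using BV U1M BU0 U1U0 by auto
  have split_U0: "card U0 = card (U0 \<inter> N p) + card (U0 \<inter> M p)" if "p \<in> B \<union> U1" for p
  proof -
    have "p \<in> V" "p \<notin> U0"
      using that PV by auto
    then show ?thesis
      using card_split[OF _ U0V(1), of p] by simp
  qed
  \<comment> \<open>Four complement neighbours of \<open>p\<close> in \<open>B\<close> would give a
    rim with \<open>U0\<close>. So \<open>p\<close> has at least three common neighbours with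
    \<open>v\<close>, and two neighbours in \<open>M v\<close> would then complete a tree.\<close>
  have l1: "card (U0 \<inter> N p) \<le> 1" if p: "p \<in> U1" for p
  proof -
    have p': "p \<in> V" "p \<in> M v" "p \<notin> B"
      using p U1M BU1 by auto
    have "card (U0 \<inter> N p) \<le> card (M v \<inter> N p)"
      using finite_N U0_N by (intro card_mono) auto
    then have 5: "5 \<le> card (U0 \<inter> M p)"
      using l2[OF p] split_U0[of p] p U0_7 by auto
    have "card (B \<inter> M p) \<le> 3"
    proof (rule ccontr)
      assume *: "\<not> card (B \<inter> M p) \<le> 3"
      have "card (U0 \<inter> M p \<inter> N z) \<le> 0" if "z \<in> B \<inter> M p" for z
      proof -
        have "U0 \<inter> M p \<inter> N z = {}"
          using nonadj that E_comm by blast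
        then show ?thesis
          by simp
      qed
      moreover have "B \<inter> M p \<inter> (U0 \<inter> M p) = {}"
        using nonadj by blast
      ultimately show False
        using * 5 by (intro no_bipartite[OF p'(1), of "B \<inter> M p" "U0 \<inter> M p" 0]) auto
    qed
    moreover have "card B = card (B \<inter> N p) + card (B \<inter> M p)"
      using card_split[OF p'(1) BV] p'(3) by simp
    moreover have "card (B \<inter> N p) = card (N v \<inter> N p)"
      using p'(2) E_comm by (intro arg_cong[of _ _ card]) (auto simp: B_def)
    ultimately have k: "3 \<le> card (N v \<inter> N p)"
      using cB D4 n by linarith
    have "card (M v \<inter> N p) \<le> 1"
    proof (rule ccontr)
      assume "\<not> card (M v \<inter> N p) \<le> 1"
      then show False
        using p' k D4 D(2) n by (intro tree_at[of v p]) auto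
    qed
    then show ?thesis
      using \<open>card (U0 \<inter> N p) \<le> card (M v \<inter> N p)\<close> by simp
  qed
  have l1': "card (U0 \<inter> N p) \<le> 1" if "p \<in> B \<union> U1" for p
  proof (cases "p \<in> B")
    case True
    then have "U0 \<inter> N p = {}"
      using nonadj E_comm by blast
    then show ?thesis
      by simp
  qed (use l1 that in blast)
  have "card ((B \<union> U1) \<inter> M p) \<le> 3" if p: "p \<in> B \<union> U1" for p
  proof (rule ccontr)
    assume *: "\<not> card ((B \<union> U1) \<inter> M p) \<le> 3"
    have "6 \<le> card (U0 \<inter> M p)"
      using split_U0[OF p] l1'[OF p] U0_7 by simp
    moreover have "card (U0 \<inter> M p \<inter> N z) \<le> 1" if z: "z \<in> (B \<union> U1) \<inter> M p" for z
    proof -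
      have "card (U0 \<inter> M p \<inter> N z) \<le> card (U0 \<inter> N z)"
        using fU0 by (intro card_mono) auto
      then show ?thesis
        using l1'[of z] z by auto
    qed
    moreover have "p \<in> V" "(B \<union> U1) \<inter> M p \<inter> (U0 \<inter> M p) = {}"
      using p PV by blast+
    ultimately show False
      using * by (intro no_bipartite[of p "(B \<union> U1) \<inter> M p" "U0 \<inter> M p" 1]) auto
  qed
  moreover have "n \<le> card (B \<union> U1)"
    using card_Un_disjoint[OF fB fU1 BU1] cB cU0 cU U0_less by linarith
  ultimately show False
    using PV(1) by (intro spanning_tree[of "B \<union> U1"]) auto
qed

section \<open>All degrees at most \<open>n - 6\<close>\<close>

lemma ex_degree_ge: "\<exists>v\<in>V. n - 5 \<le> card (N v)"
proof (rule ccontr)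
  assume "\<not> ?thesis"
  then have deg: "card (N y) + 6 \<le> n" if "y \<in> V" for y
    using that n by fastforce
  \<comment> \<open>Degree 3 ensures \<open>4 \<le> card A\<close>, which
    \<open>no_bipartite\<close> requires in \<open>L_nbrs\<close> even for
    \<open>m = 0\<close>.\<close>
  have "\<exists>x\<in>V. 3 \<le> card (N x)"
  proof (rule ccontr)
    assume "\<not> ?thesis"
    then have deg2: "card (N y) \<le> 2" if "y \<in> V" for y
      using that by fastforce
    obtain x where x: "x \<in> V"
      using card_V n by fastforce
    have cM: "14 \<le> card (M x)"
      using card_N_M[OF x] deg2[OF x] n by linarith
    then have "4 \<le> card (M x)"
      by simp
    then obtain Z where Z: "Z \<subseteq> M x" "card Z = 4" "finite Z"
      by (rule obtain_subset_with_card_n)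
    have "card (M x - Z) = card (M x) - 4"
      using card_Diff_subset[OF Z(3,1)] Z(2) by simp
    moreover have "card ((M x - Z) \<inter> N z) \<le> 2" if "z \<in> Z" for z
    proof -
      have "card ((M x - Z) \<inter> N z) \<le> card (N z)"
        using finite_N by (intro card_mono) auto
      then show ?thesis
        using deg2[of z] that Z(1) by auto
    qed
    ultimately show False
      using Z cM by (intro no_bipartite[OF x, of Z "M x - Z" 2]) auto
  qed
  then obtain x where x: "x \<in> V" "3 \<le> card (N x)"
    by blast
  define A where "A = insert x (N x)"
  define B where "B = M x"
  have fA: "finite A" and cA: "card A = card (N x) + 1"
    using finite_N E_irrefl by (auto simp: A_def)
  have AB: "A \<inter> B = {}" "A \<union> B = V" and fB: "finite B"
    using x(1) N_subset finite_V by (auto simp: A_def B_def)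
  have AV: "A \<subseteq> V" and BV: "B \<subseteq> V"
    using AB by auto
  have cAB: "card A + card B = 2 * n - 1"
    using card_Un_disjoint[OF fA fB AB(1)] AB(2) card_V by simp
  have cB: "n + 4 \<le> card B"
    using cAB cA deg[OF x(1)] n by linarith
  \<comment> \<open>Since degrees are at most \<open>n - 6\<close>, each neighbour in
    \<open>A\<close> leaves one fewer possible in \<open>B\<close>, hence more complement neighbours
    there.\<close>
  have ed: "card (A \<inter> N y) + card B + 5 \<le> n + card (B \<inter> M y)" if y: "y \<in> B" for y
  proof -
    have "y \<in> V"
      using y BV by blast
    have "N y = (A \<inter> N y) \<union> (B \<inter> N y)"
      using AB(2) N_subset by blast
    then have "card (N y) = card (A \<inter> N y) + card (B \<inter> N y)"
      using card_Un_disjoint[of "A \<inter> N y" "B \<inter> N y"] fA fB AB(1) by auto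
    then show ?thesis
      using card_split[OF \<open>y \<in> V\<close> BV] y deg[OF \<open>y \<in> V\<close>] by auto
  qed
  \<comment> \<open>About a third of \<open>A\<close>: vertices of \<open>B\<close> with at most
    \<open>m\<close> neighbours in \<open>A\<close> leave room for \<open>no_bipartite\<close>,
    while those with more gain enough from \<open>ed\<close> for \<open>H_deg\<close>.\<close>
  define m where "m = (card A - 3) div 3"
  have m: "3 * m + 3 \<le> card A" "card A \<le> 3 * m + 5" "4 \<le> card A"
    using cA x(2) by (auto simp: m_def)
  define L where "L = {y\<in>B. card (A \<inter> N y) \<le> m}"
  define H where "H = B - L"
  have LB: "L \<subseteq> B" and HB: "H \<subseteq> B" and HL: "H \<inter> L = {}" "H \<union> L = B"
    by (auto simp: L_def H_def)
  have fL: "finite L" and fH: "finite H"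
    using fB LB HB by (auto intro: finite_subset)
  have L_nbrs: "card (L \<inter> M y) \<le> 3" if y: "y \<in> L" for y
  proof (rule ccontr)
    assume *: "\<not> card (L \<inter> M y) \<le> 3"
    have y': "y \<in> V" "y \<notin> A" "card (A \<inter> N y) \<le> m"
      using y BV AB(1) by (auto simp: L_def)
    have Y: "card A - m \<le> card (A \<inter> M y)"
      using card_split[OF y'(1) AV] y'(2,3) by simp
    have "card (A \<inter> M y \<inter> N z) \<le> m" if z: "z \<in> L \<inter> M y" for z
    proof -
      have "card (A \<inter> M y \<inter> N z) \<le> card (A \<inter> N z)"
        using fA by (intro card_mono) auto
      then show ?thesis
        using z by (auto simp: L_def)
    qed
    moreover have "L \<inter> M y \<inter> (A \<inter> M y) = {}"
      using LB AB(1) by blast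
    moreover have "m + 4 \<le> card (A \<inter> M y)" "2 * m + 2 \<le> card (A \<inter> M y)"
      using Y m by linarith+
    ultimately show False
      using * by (intro no_bipartite[OF y'(1), of "L \<inter> M y" "A \<inter> M y" m]) auto
  qed
  have H_deg: "card B + 16 \<le> 3 * card (B \<inter> M y)" if "y \<in> H" for y
  proof -
    have "m + 1 \<le> card (A \<inter> N y)" "y \<in> B"
      using that by (auto simp: H_def L_def)
    then show ?thesis
      using ed[of y] m(2) cAB cB n by linarith
  qed
  have H6: "card H \<le> 6"
  proof (rule ccontr)
    assume "\<not> card H \<le> 6"
    then have H7: "7 \<le> card H"
      by simp
    \<comment> \<open>Two of the six common neighbours may be lost to the other vertices of a
      four-cycle in \<open>Q\<close>, which leaves the four that suffice for
      \<open>has_C8_greedy\<close>. Six is attained because three pairs share at least 16 in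
      total.\<close>
    define Q where "Q = (\<lambda>y z. 6 \<le> card (B \<inter> M y \<inter> M z))"
    have indep: "Q p q \<or> Q q r \<or> Q p r" if pqr: "{p, q, r} \<subseteq> H" "distinct [p, q, r]" for p q r
    proof -
      let ?X = "\<lambda>y. B \<inter> M y"
      have "card (?X p) + card (?X q) = card (?X p \<union> ?X q) + card (?X p \<inter> ?X q)"
        using fB by (intro card_Un_Int) auto
      moreover have "card (?X p \<union> ?X q) + card (?X r) = card (?X p \<union> ?X q \<union> ?X r) + card ((?X p \<union> ?X q) \<inter> ?X r)"
        using fB by (intro card_Un_Int) auto
      moreover have "card ((?X p \<union> ?X q) \<inter> ?X r) \<le> card (?X p \<inter> ?X r) + card (?X q \<inter> ?X r)"
        using card_Un_le[of "?X p \<inter> ?X r" "?X q \<inter> ?X r"] by (simp add: Int_Un_distrib2)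
      moreover have "card (?X p \<union> ?X q \<union> ?X r) \<le> card B"
        using fB by (intro card_mono) auto
      moreover have "card B + 16 \<le> 3 * card (?X p)" "card B + 16 \<le> 3 * card (?X q)"
          "card B + 16 \<le> 3 * card (?X r)"
        using H_deg pqr(1) by auto
      ultimately have "16 \<le> card (?X p \<inter> ?X q) + card (?X p \<inter> ?X r) + card (?X q \<inter> ?X r)"
        by linarith
      moreover have "?X y \<inter> ?X z = B \<inter> M y \<inter> M z" for y z
        by auto
      ultimately show ?thesis
        unfolding Q_def by auto
    qed
    have "symp Q"
      by (auto simp: symp_def Q_def Int_ac)
    then have "\<exists>a b c d. {a, b, c, d} \<subseteq> H \<and> distinct [a, b, c, d] \<and> Q a b \<and> Q b c \<and> Q c d \<and> Q d a"
      using H7 indep by (rule ex_C4_of_card_ge_7)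
    then obtain a b c d where abcd: "{a, b, c, d} \<subseteq> H" "distinct [a, b, c, d]"
        and Qs: "Q a b" "Q b c" "Q c d" "Q d a"
      by (elim exE conjE)
    define Y where "Y = B - {a, b, c, d}"
    have common: "4 \<le> card {y\<in>Y. (p \<noteq> y \<and> \<not> E p y) \<and> (q \<noteq> y \<and> \<not> E q y)}"
      if "Q p q" "{a, b, c, d} = {p, q, r, s}" for p q r s
    proof -
      have "card (B \<inter> M p \<inter> M q - {r, s}) \<le> card {y\<in>Y. (p \<noteq> y \<and> \<not> E p y) \<and> (q \<noteq> y \<and> \<not> E q y)}"
        using fB that(2) by (intro card_mono) (auto simp: Y_def)
      moreover have "card (B \<inter> M p \<inter> M q) - card {r, s} \<le> card (B \<inter> M p \<inter> M q - {r, s})"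
        by (intro diff_card_le_card_Diff) auto
      moreover have "card {r, s} \<le> 2"
        by (simp add: card_insert_if)
      ultimately show ?thesis
        using that(1) unfolding Q_def by linarith
    qed
    have "has_C8 (\<lambda>x y. x \<noteq> y \<and> \<not> E x y) ({a, b, c, d} \<union> Y)"
    proof (rule has_C8_greedy[OF symp_nonadjacent abcd(2)])
      show "{a, b, c, d} \<inter> Y = {}"
        by (auto simp: Y_def)
    qed (use common[OF Qs(1), of c d] common[OF Qs(2), of a d] common[OF Qs(3), of a b]
          common[OF Qs(4), of b c] in \<open>auto simp: insert_commute\<close>)
    moreover have "{a, b, c, d} \<union> Y \<subseteq> M x"
      using abcd(1) HB by (auto simp: Y_def B_def)
    ultimately have "has_C8 (\<lambda>x y. x \<noteq> y \<and> \<not> E x y) (M x)"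
      by (rule has_C8_mono)
    then show False
      using no_wheel[OF x(1)] by simp
  qed
  have cHL: "card H + card L = card B"
    using card_Un_disjoint[OF fH fL HL(1)] HL(2) by simp
  \<comment> \<open>\<open>y\<close> has at least nine complement neighbours in \<open>B\<close>, at
    most three of them in \<open>L\<close>; the other six exhaust \<open>H\<close>.\<close>
  have full: "card H = 6" "H \<subseteq> M y" if y: "y \<in> L" for y
  proof -
    have "9 \<le> card (B \<inter> M y)"
      using ed[of y] y LB cB by auto
    moreover have "B \<inter> M y = (H \<inter> M y) \<union> (L \<inter> M y)"
      using HL(2) by blast
    ultimately have 6: "6 \<le> card (H \<inter> M y)"
      using L_nbrs[OF y] card_Un_le[of "H \<inter> M y" "L \<inter> M y"] by simp
    moreover have "card (H \<inter> M y) \<le> card H"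
      using fH by (intro card_mono) auto
    ultimately have eq: "card (H \<inter> M y) = card H"
      using H6 by simp
    then show "card H = 6"
      using 6 H6 by simp
    have "H \<inter> M y = H"
      using eq fH by (intro card_subset_eq) auto
    then show "H \<subseteq> M y"
      by blast
  qed
  have L7: "7 \<le> card L"
    using cHL H6 cB n by linarith
  then obtain y where "y \<in> L"
    by fastforce
  have "card (L \<inter> N z) \<le> 0" if "z \<in> H" for z
  proof -
    have "L \<inter> N z = {}"
      using full(2) that E_comm by blast
    then show ?thesis
      by simp
  qed
  then show False
    using full(1)[OF \<open>y \<in> L\<close>] L7 HB LB HL(1) unfolding B_def
    by (intro no_bipartite[OF x(1), of H L 0]) auto
qed

lemma contradiction: False
proof -
  obtain v where "v \<in> V" "n - 5 \<le> card (N v)"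
    using ex_degree_ge by blast
  moreover from this have "card (N v) \<le> n - 3"
    using degree_less[of v] degree_neq[of v] by linarith
  ultimately show False
    by (rule degree_not_between)
qed

end

subsection \<open>The Ramsey number\<close>

lemma star_tree_5:
  assumes "9 \<le> n"
  shows "verts (star_tree n 5) = {..<n}"
    and "edges (star_tree n 5) =
      {{0, x} | x. x \<in> {1..<n - 5}} \<union> {{n - 5, x} | x. x \<in> {n - 4..<n}} \<union> {{0, n - 4}}"
proof -
  have "n - 5 + 1 = n - 4"
    using assms by simp
  then show "verts (star_tree n 5) = {..<n}"
    and "edges (star_tree n 5) =
      {{0, x} | x. x \<in> {1..<n - 5}} \<union> {{n - 5, x} | x. x \<in> {n - 4..<n}} \<union> {{0, n - 4}}"
    using assms by (auto simp: star_tree_def star_def Let_def)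
qed

text \<open>Supplies \<open>no_tree\<close>. The centres \<open>0\<close> and \<open>n - 5\<close>
  go to \<open>v\<close> and \<open>w\<close>, and \<open>n - 4\<close>, the leaf joined to both,
  goes to \<open>u\<close>.\<close>

lemma contains_star_tree:
  assumes n: "9 \<le> n" and F: "simple_graph F"
    and vwu: "v \<noteq> w" "{v, u} \<in> edges F" "{w, u} \<in> edges F"
    and L: "L \<subseteq> {y. {w, y} \<in> edges F} - {v, u}" "card L = 3"
    and K: "n - 6 \<le> card ({y. {v, y} \<in> edges F} - ({u, w} \<union> L))"
  shows "contains_subgraph F (star_tree n 5)"
proof -
  have edge: "x \<in> verts F \<and> y \<in> verts F \<and> x \<noteq> y" if "{x, y} \<in> edges F" for x y
    using that F by (auto simp: simple_graph_def nsets_def)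
  obtain P where P: "P \<subseteq> {y. {v, y} \<in> edges F} - ({u, w} \<union> L)" "card P = n - 6" "finite P"
    using obtain_subset_with_card_n[OF K] by blast
  have fL: "finite L"
    using L(2) card.infinite by force
  have "card {1..<n - 5} = card P" "card {n - 3..<n} = card L"
    using P L n by simp_all
  then obtain g h where g: "bij_betw g {1..<n - 5} P" and h: "bij_betw h {n - 3..<n} L"
    using finite_same_card_bij[of "{1..<n - 5}" P] finite_same_card_bij[of "{n - 3..<n}" L] P(3) fL by auto
  define f where "f = (\<lambda>i. if i = 0 then v else if i = n - 5 then w else if i = n - 4 then u
    else if i < n - 5 then g i else h i)"
  have f0: "f 0 = v" "f (n - 5) = w" "f (n - 4) = u"
    using n by (auto simp: f_def)
  have fg: "f i = g i" if "i \<in> {1..<n - 5}" for i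
    using that n by (auto simp: f_def)
  have fh: "f i = h i" if "i \<in> {n - 3..<n}" for i
    using that n by (auto simp: f_def)
  have fP: "f ` {1..<n - 5} = P" and fL': "f ` {n - 3..<n} = L"
    using fg fh g h by (simp_all add: bij_betw_def)
  have parts: "{..<n} = {0, n - 5, n - 4} \<union> {1..<n - 5} \<union> {n - 3..<n}"
    using n by auto
  have img: "f ` {..<n} = {v, w, u} \<union> P \<union> L"
    unfolding parts image_Un fP fL' using f0 by simp
  have "card {v, w, u} = 3"
    using vwu edge by (auto simp: card_insert_if)
  moreover have "{v, w, u} \<inter> P = {}" "({v, w, u} \<union> P) \<inter> L = {}"
    using P L edge by blast+
  \<comment> \<open>Injectivity follows by counting: the image of the \<open>n\<close> labels has
    \<open>n\<close> elements.\<close>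
  ultimately have "card ({v, w, u} \<union> P \<union> L) = n"
    using P(2,3) fL L(2) n by (simp only: card_Un_disjoint finite_Un finite_insert finite.emptyI)
  then have "inj_on f (verts (star_tree n 5))"
    using img by (simp add: star_tree_5[OF n] eq_card_imp_inj_on)
  moreover have "f ` verts (star_tree n 5) \<subseteq> verts F"
    using img P L edge vwu unfolding star_tree_5[OF n] by auto
  moreover have "f ` e \<in> edges F" if e: "e \<in> edges (star_tree n 5)" for e
  proof -
    have c1: "{v, f x} \<in> edges F" if "x \<in> {1..<n - 5}" for x
    proof -
      have "f x \<in> P"
        using fP that by blast
      then show ?thesis
        using P(1) by blast
    qed
    have c2: "{w, f x} \<in> edges F" if "x \<in> {n - 4..<n}" for x
    proof (cases "x = n - 4")
      case False
      then have "x \<in> {n - 3..<n}"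
        using that by auto
      then have "f x \<in> L"
        using fL' by blast
      then show ?thesis
        using L(1) by blast
    qed (simp add: f0 vwu)
    show ?thesis
      using e c1 c2 vwu unfolding star_tree_5[OF n] by (auto simp: f0)
  qed
  ultimately show ?thesis
    unfolding contains_subgraph_def by blast
qed

lemma contains_wheel_8:
  assumes h: "h \<in> verts F"
    and C8: "has_C8 (\<lambda>x y. x \<noteq> y \<and> {x, y} \<notin> edges F) {y\<in>verts F. y \<noteq> h \<and> {h, y} \<notin> edges F}"
  shows "contains_subgraph (complement F) (wheel 8)"
proof -
  obtain xs where xs: "length xs = 8" "distinct xs" "set xs \<subseteq> {y\<in>verts F. y \<noteq> h \<and> {h, y} \<notin> edges F}"
      and cyc: "successively (\<lambda>x y. x \<noteq> y \<and> {x, y} \<notin> edges F) (xs @ [hd xs])"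
    using C8 unfolding has_C8_def by blast
  define f where "f = (\<lambda>i. if i < 8 then xs ! i else h)"
  have in_set: "xs ! i \<in> set xs" if "i < 8" for i
    using that xs(1) by simp
  have rim: "xs ! i \<noteq> xs ! (Suc i mod 8) \<and> {xs ! i, xs ! (Suc i mod 8)} \<notin> edges F" if i: "i < 8" for i
  proof -
    \<comment> \<open>The appended head has index 8, which is 0 modulo 8.\<close>
    have "(xs @ [hd xs]) ! Suc i = xs ! (Suc i mod 8)"
    proof (cases "Suc i = 8")
      case True
      then show ?thesis
        using xs(1) by (cases xs) (auto simp: nth_append)
    qed (use i xs(1) in \<open>simp add: nth_append\<close>)
    moreover have "(xs @ [hd xs]) ! i = xs ! i"
      using i xs(1) by (simp add: nth_append)
    ultimately show ?thesis
      using cyc i xs(1) unfolding successively_conv_nth by (metis Suc_less_eq length_append_singleton)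
  qed
  have pair: "{x, y} \<in> edges (complement F)"
    if "x \<in> verts F" "y \<in> verts F" "x \<noteq> y" "{x, y} \<notin> edges F" for x y
    using that by (auto simp: complement_def nsets_def card_insert_if)
  have "xs ! i \<noteq> h" if "i < 8" for i
    using in_set[OF that] xs(3) by auto
  then have "inj_on f {..8}"
    using xs(1,2) by (auto simp: inj_on_def f_def nth_eq_iff_index_eq)
  moreover have "f ` {..8} \<subseteq> verts (complement F)"
    using h in_set xs(3) by (auto simp: f_def complement_def)
  moreover have "f ` {i, Suc i mod 8} \<in> edges (complement F)" if i: "i < 8" for i
  proof -
    have "f ` {i, Suc i mod 8} = {xs ! i, xs ! (Suc i mod 8)}"
      using i by (simp add: f_def)
    then show ?thesis
      using pair rim[OF i] in_set[OF i] in_set[of "Suc i mod 8"] xs(3) by auto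
  qed
  moreover have "f ` {8, i} \<in> edges (complement F)" if i: "i < 8" for i
  proof -
    have "f ` {8, i} = {h, xs ! i}"
      using i by (simp add: f_def)
    then show ?thesis
      using pair[of h "xs ! i"] h in_set[OF i] xs(3) by auto
  qed
  ultimately show ?thesis
    unfolding contains_subgraph_def wheel_def by (intro exI[of _ f]) auto
qed

section \<open>The lower and the upper bound\<close>

text \<open>The tree is connected, so a copy would fit into one clique. The complement is bipartite,
  whereas the hub and two consecutive rim vertices form a triangle. Every smaller \<open>N\<close>
  is refuted, as the \<open>LEAST\<close> in \<open>ramsey_number\<close> demands.\<close>

lemma not_ramsey_arrow:
  assumes n: "9 \<le> n" and N: "N < 2 * n - 1"
  shows "\<not> ramsey_arrow N (star_tree n 5) (wheel 8)"
proof
  assume arrow: "ramsey_arrow N (star_tree n 5) (wheel 8)"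
  define side where "side = (\<lambda>i. i < n - 1)"
  define F where "F = \<lparr>verts = {..<N}, edges = {{i, j} | i j. i < N \<and> j < N \<and> i \<noteq> j \<and> side i = side j}\<rparr>"
  have "simple_graph F" "card (verts F) = N"
    by (auto simp: simple_graph_def F_def nsets_def card_insert_if)
  then consider "contains_subgraph F (star_tree n 5)" | "contains_subgraph (complement F) (wheel 8)"
    using arrow unfolding ramsey_arrow_def by blast
  then show False
  proof cases
    case 1
    then obtain f where f: "inj_on f {..<n}" "f ` {..<n} \<subseteq> {..<N}"
        and E: "\<forall>e\<in>edges (star_tree n 5). f ` e \<in> edges F"
      unfolding contains_subgraph_def star_tree_5[OF n] F_def by auto
    have side: "side (f i) = side (f j)" if "{i, j} \<in> edges (star_tree n 5)" for i j
    proof -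
      have "{f i, f j} \<in> edges F"
        using E that by force
      then show ?thesis
        by (auto simp: F_def doubleton_eq_iff)
    qed
    have s1: "side (f x) = side (f 0)" if "x \<in> {1..<n - 5} \<union> {n - 4}" for x
      using that side[of 0 x] unfolding star_tree_5[OF n] by auto
    have s2: "side (f x) = side (f (n - 5))" if "x \<in> {n - 4..<n}" for x
      using that side[of "n - 5" x] unfolding star_tree_5[OF n] by auto
    have s3: "side (f (n - 5)) = side (f 0)"
      using s1[of "n - 4"] s2[of "n - 4"] n by simp
    have same: "side (f x) = side (f 0)" if x: "x < n" for x
    proof -
      have "x = 0 \<or> 1 \<le> x \<and> x < n - 5 \<or> x = n - 5 \<or> n - 4 \<le> x"
        using n by arith
      then consider "x = 0" | "x \<in> {1..<n - 5}" | "x = n - 5" | "x \<in> {n - 4..<n}"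
        using x by auto
      then show ?thesis
        using s1 s2 s3 by cases auto
    qed
    have "f x \<in> (if side (f 0) then {..<n - 1} else {n - 1..<N})" if "x < n" for x
    proof -
      have "f x < N"
        using f(2) that by auto
      then show ?thesis
        using same[OF that] by (auto simp: side_def)
    qed
    then have "f ` {..<n} \<subseteq> (if side (f 0) then {..<n - 1} else {n - 1..<N})"
      by blast
    then have "card (f ` {..<n}) \<le> card (if side (f 0) then {..<n - 1} else {n - 1..<N})"
      by (intro card_mono) auto
    then show False
      using card_image[OF f(1)] N n by (auto split: if_splits)
  next
    case 2
    then obtain f where f: "inj_on f {..8 :: nat}" "f ` {..8} \<subseteq> {..<N}"
        and E: "\<forall>e\<in>edges (wheel 8). f ` e \<in> edges (complement F)"
      unfolding contains_subgraph_def by (auto simp: wheel_def complement_def F_def)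
    have side: "side (f i) \<noteq> side (f j)" if "{i, j} \<in> edges (wheel 8)" "i \<le> 8" "j \<le> 8" "i \<noteq> j" for i j
    proof -
      have "{f i, f j} \<notin> edges F"
        using E that(1) by (force simp: complement_def)
      moreover have "f i < N" "f j < N" "f i \<noteq> f j"
        using f that(2-4) by (auto simp: inj_on_eq_iff)
      ultimately show ?thesis
        by (auto simp: F_def)
    qed
    have "{0, 1} \<in> edges (wheel 8)" "{8, 0} \<in> edges (wheel 8)" "{8, 1} \<in> edges (wheel 8)"
      by (auto simp: wheel_def intro: exI[of _ 0])
    then show False
      using side[of 0 1] side[of 8 0] side[of 8 1] by auto
  qed
qed

lemma ramsey_arrow_star_tree_wheel:
  assumes n: "9 \<le> n"
  shows "ramsey_arrow (2 * n - 1) (star_tree n 5) (wheel 8)"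
  unfolding ramsey_arrow_def
proof (intro allI impI)
  fix F :: "nat sgraph"
  assume "simple_graph F \<and> card (verts F) = 2 * n - 1"
  then have F: "simple_graph F" "card (verts F) = 2 * n - 1"
    by blast+
  show "contains_subgraph F (star_tree n 5) \<or> contains_subgraph (complement F) (wheel 8)"
  proof (rule ccontr)
    assume no: "\<not> ?thesis"
    have "ramsey_counterexample (verts F) (\<lambda>x y. {x, y} \<in> edges F) n"
    proof
      show "finite (verts F)" "9 \<le> n" "card (verts F) = 2 * n - 1"
        using F n by (simp_all add: simple_graph_def)
      show "{y, x} \<in> edges F" if "{x, y} \<in> edges F" for x y
        using that by (simp add: insert_commute)
      show "x \<in> verts F" if "{x, y} \<in> edges F" for x y
        using that F(1) by (auto simp: simple_graph_def nsets_def)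
      show "{x, x} \<notin> edges F" for x
        using F(1) by (auto simp: simple_graph_def nsets_def)
      show "card ({y. {v, y} \<in> edges F} - ({u, w} \<union> L)) < n - 6"
        if "v \<noteq> w" "{v, u} \<in> edges F" "{w, u} \<in> edges F"
          "L \<subseteq> {y. {w, y} \<in> edges F} - {v, u}" "card L = 3" for v w u L
        using contains_star_tree[OF n F(1) that] no by linarith
      show "\<not> has_C8 (\<lambda>x y. x \<noteq> y \<and> {x, y} \<notin> edges F) {y\<in>verts F. y \<noteq> h \<and> {h, y} \<notin> edges F}"
        if "h \<in> verts F" for h
        using contains_wheel_8[OF that] no by blast
    qed
    then show False
      by (rule ramsey_counterexample.contradiction)
  qed
qed

theorem theorem20:
  fixes n :: nat
  assumes "n \<ge> 9"
  shows "ramsey_number (star_tree n 5) (wheel 8) = 2 * n - 1"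
  unfolding ramsey_number_def
proof (rule Least_equality)
  show "ramsey_arrow (2 * n - 1) (star_tree n 5) (wheel 8)"
    using assms by (rule ramsey_arrow_star_tree_wheel)
  show "2 * n - 1 \<le> N" if "ramsey_arrow N (star_tree n 5) (wheel 8)" for N
    using not_ramsey_arrow[OF assms, of N] that by linarith
qed

end
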